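(* Let $\tau:\mathbb{U}\to\Omega$, $\tau(z)=\frac{az+b}{cz+d}$, be a linear fractional Riemann map with real coefficients $a,b,c,d$, let $\Psi$ be an analytic self-map of $\Omega$ inducing a unitary composition operator $C_\Psi$ on $H^{2}(\Omega)$, and let $\Phi$ be an analytic self-map of $\Omega$ such that $C_{\Phi}$ is $J_{\Omega,\Psi}$-symmetric on $H^{2}(\Omega)$. (1) If $|c|^{2}=|d|^{2}$, then there is $r\in\mathbb{C}$ such that $\Phi(w)=w+r$ for all $w\in\Omega$. (2) If $|c|^{2}\neq|d|^{2}$, then there is $r\in\mathbb{C}$ such that $\Phi(w)=rw+\frac{(r-1)(bd-ac)}{|c|^{2}-|d|^{2}}$ for all $w\in\Omega$. Conversely, suppose that either $|c|^2=|d|^2$ and $\Phi(w)=w+r$ with $r\in\mathbb{C}$, or $|c|^2\neq|d|^2$ and $\Phi(w)=rw+\frac{(r-1)(bd-ac)}{|c|^{2}-|d|^{2}}$ with $r\in\mathbb{C}$. If $\Phi$ is an analytic self-map of $\Omega$ such that $C_{\Phi}$ is bounded on $H^{2}(\Omega)$, then $C_{\Phi}$ is $J_{\Omega,\Psi}$-symmetric.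
   Context: $\mathbb{U}$ is the open unit disc and $\Omega$ is an open simply connected proper subset of $\mathbb{C}$. A Riemann map $\tau:\mathbb{U}\to\Omega$ is a biholomorphic map of $\mathbb{U}$ onto $\Omega$; it is a linear fractional Riemann map if $\tau(z)=\frac{az+b}{cz+d}$ with $ad-bc\neq0$. The Hardy-Smirnov space $H^{2}(\Omega)$ is the set of analytic $f:\Omega\to\mathbb{C}$ with $\|f\|^{2}=\sup_{0<r<1}\frac{1}{2\pi}\int_{\Gamma_r}|f(w)|^{2}|dw|<\infty$, where $\Gamma_r=\tau(\{|z|=r\})$; the norm is the one induced by the given $\tau$. Fix an analytic branch of $(\tau')^{1/2}$ on $\mathbb{U}$. The map $Vf=(f\circ\tau)(\tau')^{1/2}$ is an isometric isomorphism from $H^2(\Omega)$ onto the classical Hardy space $H^2(\mathbb{U})$, and $H^{2}(\Omega)$ is a Hilbert space with inner product $\langle f,g\rangle=\langle Vf,Vg\rangle_{2}$, where $\langle\cdot,\cdot\rangle_2$ is the inner product of $H^2(\mathbb{U})$, $\langle F,G\rangle_2=\sum_{n\ge0}\widehat F(n)\overline{\widehat G(n)}$ (Maclaurin coefficients). For an analytic self-map $\Phi$ of $\Omega$, $C_{\Phi}f=f\circ\Phi$. A conjugation $C$ on a complex Hilbert space $\mathcal H$ is a conjugate-linear map with $\langle Cf,Cg\rangle=\langle g,f\rangle$ for all $f,g$ and $C^2=Id$. A bounded operator $T$ is $C$-symmetric if $CT=T^*C$, and unitary if $TT^*=T^*T=Id$. On $H^2(\mathbb{U})$ let $J$ be the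 conjugation $(Jf)(z)=\overline{f(\overline z)}$, and let $J_\Omega=V^{-1}JV$, a conjugation on $H^2(\Omega)$. If $\Psi$ induces a unitary composition operator on $H^2(\Omega)$, then $J_{\Omega,\Psi}:=C_{\Psi}J_{\Omega}C_{\Psi}^{-1}$ is a conjugation on $H^2(\Omega)$. *)

theory Defs
  imports "HOL-Complex_Analysis.Complex_Analysis"
begin

text \<open>
  Analytic functions on an open set \<open>\<Omega>\<close> are represented by total functions that are
  holomorphic on \<open>\<Omega>\<close> and vanish off \<open>\<Omega>\<close>. Thus equality of functions on
  \<open>\<Omega>\<close> is HOL equality, and the linear structure is the pointwise one.
\<close>

definition riemann_map :: "(complex \<Rightarrow> complex) \<Rightarrow> complex set \<Rightarrow> bool" where
  "riemann_map \<tau> \<Omega> \<longleftrightarrow>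
     \<tau> holomorphic_on ball 0 1 \<and> \<tau> ` ball 0 1 = \<Omega> \<and>
     (\<exists>\<sigma>. \<sigma> holomorphic_on \<Omega> \<and> \<sigma> ` \<Omega> = ball 0 1 \<and>
        (\<forall>z\<in>ball 0 1. \<sigma> (\<tau> z) = z) \<and> (\<forall>w\<in>\<Omega>. \<tau> (\<sigma> w) = w))"

definition analytic_self_map :: "complex set \<Rightarrow> (complex \<Rightarrow> complex) \<Rightarrow> bool" where
  "analytic_self_map \<Omega> \<Phi> \<longleftrightarrow> \<Phi> holomorphic_on \<Omega> \<and> \<Phi> ` \<Omega> \<subseteq> \<Omega>"

definition analytic_sqrt_deriv :: "(complex \<Rightarrow> complex) \<Rightarrow> (complex \<Rightarrow> complex) \<Rightarrow> bool" where
  "analytic_sqrt_deriv \<tau> s \<longleftrightarrow>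
     s holomorphic_on ball 0 1 \<and> (\<forall>z\<in>ball 0 1. (s z)\<^sup>2 = deriv \<tau> z)"


subsection \<open>Hardy--Smirnov spaces\<close>

definition arclength_integral :: "(real \<Rightarrow> complex) \<Rightarrow> (complex \<Rightarrow> real) \<Rightarrow> real" where
  "arclength_integral \<gamma> g =
     integral {0..1} (\<lambda>t. g (\<gamma> t) * norm (vector_derivative \<gamma> (at t within {0..1})))"

text \<open>
  Since \<open>\<tau>\<close> is injective, \<open>\<tau> \<circ> circlepath 0 r\<close> traverses the curve
  \<open>\<tau>({z. |z| = r})\<close> exactly once.
\<close>

definition hardy_smirnov :: "(complex \<Rightarrow> complex) \<Rightarrow> complex set \<Rightarrow> (complex \<Rightarrow> complex) set" where
  "hardy_smirnov \<tau> \<Omega> =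
     {f. f holomorphic_on \<Omega> \<and> (\<forall>w. w \<notin> \<Omega> \<longrightarrow> f w = 0) \<and>
         bdd_above ((\<lambda>r. 1 / (2 * pi) *
           arclength_integral (\<tau> \<circ> circlepath 0 r) (\<lambda>w. (cmod (f w))\<^sup>2)) ` {0<..<1})}"

definition maclaurin_coeff :: "(complex \<Rightarrow> complex) \<Rightarrow> nat \<Rightarrow> complex" where
  "maclaurin_coeff F n = (deriv ^^ n) F 0 / fact n"

definition hardy_inner :: "(complex \<Rightarrow> complex) \<Rightarrow> (complex \<Rightarrow> complex) \<Rightarrow> complex" where
  "hardy_inner F G = (\<Sum>n. maclaurin_coeff F n * cnj (maclaurin_coeff G n))"

definition hs_V :: "(complex \<Rightarrow> complex) \<Rightarrow> (complex \<Rightarrow> complex) \<Rightarrow>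
    (complex \<Rightarrow> complex) \<Rightarrow> (complex \<Rightarrow> complex)" where
  "hs_V \<tau> s f = (\<lambda>z. if z \<in> ball 0 1 then f (\<tau> z) * s z else 0)"

text \<open>
  As \<open>V\<close> is isometric, the norm of the following inner product is the square root of
  the supremum of the arc-length means in \<open>hardy_smirnov\<close>.
\<close>

definition hs_inner :: "(complex \<Rightarrow> complex) \<Rightarrow> (complex \<Rightarrow> complex) \<Rightarrow>
    (complex \<Rightarrow> complex) \<Rightarrow> (complex \<Rightarrow> complex) \<Rightarrow> complex" where
  "hs_inner \<tau> s f g = hardy_inner (hs_V \<tau> s f) (hs_V \<tau> s g)"

definition comp_op :: "complex set \<Rightarrow> (complex \<Rightarrow> complex) \<Rightarrow>
    (complex \<Rightarrow> complex) \<Rightarrow> (complex \<Rightarrow> complex)" where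
  "comp_op \<Omega> \<Phi> f = (\<lambda>w. if w \<in> \<Omega> then f (\<Phi> w) else 0)"


subsection \<open>Operators on a Hilbert space of functions\<close>

text \<open>
  A Hilbert space is given by its carrier \<open>H\<close> and its inner product \<open>ip\<close>
  (linear in the first argument); operators matter only on \<open>H\<close>.
\<close>

definition ip_norm :: "('a \<Rightarrow> 'a \<Rightarrow> complex) \<Rightarrow> 'a \<Rightarrow> real" where
  "ip_norm ip f = sqrt (Re (ip f f))"

definition bounded_operator :: "(complex \<Rightarrow> complex) set \<Rightarrow>
    ((complex \<Rightarrow> complex) \<Rightarrow> (complex \<Rightarrow> complex) \<Rightarrow> complex) \<Rightarrow>
    ((complex \<Rightarrow> complex) \<Rightarrow> (complex \<Rightarrow> complex)) \<Rightarrow> bool" where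
  "bounded_operator H ip T \<longleftrightarrow>
     (\<forall>f\<in>H. T f \<in> H) \<and>
     (\<forall>f\<in>H. \<forall>g\<in>H. T (\<lambda>w. f w + g w) = (\<lambda>w. T f w + T g w)) \<and>
     (\<forall>k. \<forall>f\<in>H. T (\<lambda>w. k * f w) = (\<lambda>w. k * T f w)) \<and>
     (\<exists>K. \<forall>f\<in>H. ip_norm ip (T f) \<le> K * ip_norm ip f)"

text \<open>
  For a bounded operator on a Hilbert space the element described below exists and is
  unique, by the Riesz representation theorem.
\<close>

definition hilbert_adjoint :: "'a set \<Rightarrow> ('a \<Rightarrow> 'a \<Rightarrow> complex) \<Rightarrow> ('a \<Rightarrow> 'a) \<Rightarrow> 'a \<Rightarrow> 'a" where
  "hilbert_adjoint H ip T g = (THE h. h \<in> H \<and> (\<forall>f\<in>H. ip (T f) g = ip f h))"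

definition unitary_operator :: "(complex \<Rightarrow> complex) set \<Rightarrow>
    ((complex \<Rightarrow> complex) \<Rightarrow> (complex \<Rightarrow> complex) \<Rightarrow> complex) \<Rightarrow>
    ((complex \<Rightarrow> complex) \<Rightarrow> (complex \<Rightarrow> complex)) \<Rightarrow> bool" where
  "unitary_operator H ip T \<longleftrightarrow> bounded_operator H ip T \<and>
     (\<forall>f\<in>H. T (hilbert_adjoint H ip T f) = f \<and> hilbert_adjoint H ip T (T f) = f)"

definition C_symmetric :: "(complex \<Rightarrow> complex) set \<Rightarrow>
    ((complex \<Rightarrow> complex) \<Rightarrow> (complex \<Rightarrow> complex) \<Rightarrow> complex) \<Rightarrow>
    ((complex \<Rightarrow> complex) \<Rightarrow> (complex \<Rightarrow> complex)) \<Rightarrow>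
    ((complex \<Rightarrow> complex) \<Rightarrow> (complex \<Rightarrow> complex)) \<Rightarrow> bool" where
  "C_symmetric H ip C T \<longleftrightarrow> bounded_operator H ip T \<and>
     (\<forall>f\<in>H. C (T f) = hilbert_adjoint H ip T (C f))"


subsection \<open>The conjugations\<close>

definition J_disc :: "(complex \<Rightarrow> complex) \<Rightarrow> (complex \<Rightarrow> complex)" where
  "J_disc F = (\<lambda>z. cnj (F (cnj z)))"

definition J_Omega :: "(complex \<Rightarrow> complex) \<Rightarrow> (complex \<Rightarrow> complex) \<Rightarrow> complex set \<Rightarrow>
    (complex \<Rightarrow> complex) \<Rightarrow> (complex \<Rightarrow> complex)" where
  "J_Omega \<tau> s \<Omega> f =
     inv_into (hardy_smirnov \<tau> \<Omega>) (hs_V \<tau> s) (J_disc (hs_V \<tau> s f))"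

definition J_Omega_Psi :: "(complex \<Rightarrow> complex) \<Rightarrow> (complex \<Rightarrow> complex) \<Rightarrow> complex set \<Rightarrow>
    (complex \<Rightarrow> complex) \<Rightarrow> (complex \<Rightarrow> complex) \<Rightarrow> (complex \<Rightarrow> complex)" where
  "J_Omega_Psi \<tau> s \<Omega> \<Psi> f =
     comp_op \<Omega> \<Psi> (J_Omega \<tau> s \<Omega> (inv_into (hardy_smirnov \<tau> \<Omega>) (comp_op \<Omega> \<Psi>) f))"

end

theory Submission
  imports Defs
begin

text \<open>
  The reproducing kernel of \<open>H\<^sup>2(\<Omega>)\<close> at \<open>w\<close> is a constant multiple of \<open>z \<mapsto> 1 / Q(z, cnj w)\<close>, where
  \<open>Q(x, y) = (a\<^sup>2 - b\<^sup>2) + (b d - a c) (x + y) + (c\<^sup>2 - d\<^sup>2) x y\<close>. Since \<open>\<tau>\<close> has real coefficients,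
  \<open>J\<^sub>\<Omega> f\<close> is up to a sign \<open>w \<mapsto> cnj (f (cnj w))\<close>. The adjoint of a composition operator moves kernels
  to kernels, so unitarity of \<open>C\<^sub>\<Psi>\<close> says that \<open>Q(\<Psi> z, cnj (\<Psi> w)) = Q(z, cnj w)\<close>, which makes \<open>\<Psi>\<close> a
  translation if \<open>c\<^sup>2 = d\<^sup>2\<close> and a dilation about \<open>- (b d - a c) / (c\<^sup>2 - d\<^sup>2)\<close> otherwise, and
  symmetry of \<open>C\<^sub>\<Phi>\<close> says that \<open>Q(\<Psi> (\<Phi> z), \<Psi> w) = Q(\<Psi> z, \<Psi> (\<Phi> w))\<close>, which makes \<open>\<Phi>\<close> a map of the
  same kind. Conversely, for such \<open>\<Phi>\<close> the operator \<open>C\<^sub>\<Phi>\<close> sends the kernel at \<open>w\<close> to the kernel at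
  \<open>cnj (\<Phi> (cnj w))\<close>, which determines the adjoint of \<open>C\<^sub>\<Phi>\<close> pointwise; the adjoint exists by the
  Riesz representation theorem for \<open>\<ell>\<^sup>2\<close>, transported through Maclaurin coefficients.
\<close>

subsection \<open>Square-summable sequences\<close>

definition square_summable :: "(nat \<Rightarrow> complex) \<Rightarrow> bool" where
  "square_summable x \<longleftrightarrow> summable (\<lambda>n. (cmod (x n))\<^sup>2)"

lemma square_summable_mult_cnj:
  assumes "square_summable x" "square_summable y"
  shows "summable (\<lambda>n. x n * cnj (y n))"
proof (rule summable_comparison_test')
  show "summable (\<lambda>n. (cmod (x n))\<^sup>2 + (cmod (y n))\<^sup>2)"
    using assms unfolding square_summable_def by (rule summable_add)
  show "norm (x n * cnj (y n)) \<le> (cmod (x n))\<^sup>2 + (cmod (y n))\<^sup>2" for n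
    using sum_squares_bound[of "cmod (x n)" "cmod (y n)"]
      mult_nonneg_nonneg[OF norm_ge_zero norm_ge_zero, of "x n" "y n"]
    unfolding norm_mult complex_mod_cnj mult.assoc by linarith
qed

lemma square_summable_scale:
  "square_summable x \<Longrightarrow> square_summable (\<lambda>n. k * x n)"
  by (simp add: square_summable_def norm_mult power_mult_distrib summable_mult)

lemma square_summable_add:
  assumes "square_summable x" "square_summable y"
  shows "square_summable (\<lambda>n. x n + y n)"
  unfolding square_summable_def
proof (rule summable_comparison_test')
  show "summable (\<lambda>n. 2 * (cmod (x n))\<^sup>2 + 2 * (cmod (y n))\<^sup>2)"
    using assms unfolding square_summable_def by (intro summable_add summable_mult)
  show "norm ((cmod (x n + y n))\<^sup>2) \<le> 2 * (cmod (x n))\<^sup>2 + 2 * (cmod (y n))\<^sup>2" for n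
  proof -
    have "(cmod (x n + y n))\<^sup>2 \<le> (cmod (x n) + cmod (y n))\<^sup>2"
      by (simp add: norm_triangle_ineq power_mono)
    then show ?thesis
      using sum_squares_bound[of "cmod (x n)" "cmod (y n)"] by (simp add: power2_sum)
  qed
qed

lemma square_summable_finite_support:
  "(\<And>n. n \<ge> N \<Longrightarrow> x n = 0) \<Longrightarrow> square_summable x"
  unfolding square_summable_def
  by (rule summable_finite[of "{..<N}"]) (auto simp: not_less)

lemma square_summable_geometric:
  assumes "cmod z < 1"
  shows "square_summable (\<lambda>n. z ^ n)"
proof -
  have "(cmod z)\<^sup>2 < 1"
    using assms by (simp add: power_less_one_iff)
  then show ?thesis
    by (simp add: square_summable_def norm_power power_mult[symmetric] mult.commute[of _ 2])
       (simp add: power_mult summable_geometric)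
qed

text \<open>The finite inequality for \<open>L2_set\<close> bounds all partial sums uniformly, and
  the bound survives the limit.\<close>

lemma l2_Cauchy_Schwarz:
  assumes "square_summable x" "square_summable y"
  shows "cmod (\<Sum>n. x n * cnj (y n)) \<le> sqrt (\<Sum>n. (cmod (x n))\<^sup>2) * sqrt (\<Sum>n. (cmod (y n))\<^sup>2)"
proof (rule LIMSEQ_le_const2)
  show "(\<lambda>N. cmod (\<Sum>n<N. x n * cnj (y n))) \<longlonglongrightarrow> cmod (\<Sum>n. x n * cnj (y n))"
    by (intro tendsto_norm summable_LIMSEQ square_summable_mult_cnj assms)
  have "cmod (\<Sum>n<N. x n * cnj (y n)) \<le> sqrt (\<Sum>n. (cmod (x n))\<^sup>2) * sqrt (\<Sum>n. (cmod (y n))\<^sup>2)" for N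
  proof -
    have "cmod (\<Sum>n<N. x n * cnj (y n)) \<le> (\<Sum>n<N. \<bar>cmod (x n)\<bar> * \<bar>cmod (y n)\<bar>)"
      by (rule order_trans[OF norm_sum]) (simp add: norm_mult)
    also have "\<dots> \<le> L2_set (\<lambda>n. cmod (x n)) {..<N} * L2_set (\<lambda>n. cmod (y n)) {..<N}"
      by (rule L2_set_mult_ineq)
    also have "\<dots> \<le> sqrt (\<Sum>n. (cmod (x n))\<^sup>2) * sqrt (\<Sum>n. (cmod (y n))\<^sup>2)"
      using assms unfolding L2_set_def square_summable_def
      by (intro mult_mono real_sqrt_le_mono sum_le_suminf real_sqrt_ge_zero sum_nonneg suminf_nonneg)
         auto
    finally show ?thesis .
  qed
  then show "\<exists>N0. \<forall>N\<ge>N0. cmod (\<Sum>n<N. x n * cnj (y n)) \<le>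
      sqrt (\<Sum>n. (cmod (x n))\<^sup>2) * sqrt (\<Sum>n. (cmod (y n))\<^sup>2)"
    by blast
qed

text \<open>The representing sequence is forced: its m-th entry must be the conjugate of
  \<open>L\<close> on the m-th unit vector. Linearity settles finitely supported sequences, and the
  bound extends the formula to all square-summable ones.\<close>

lemma l2_Riesz:
  fixes L :: "(nat \<Rightarrow> complex) \<Rightarrow> complex"
  assumes add: "\<And>x y. square_summable x \<Longrightarrow> square_summable y \<Longrightarrow> L (\<lambda>n. x n + y n) = L x + L y"
    and scale: "\<And>k x. square_summable x \<Longrightarrow> L (\<lambda>n. k * x n) = k * L x"
    and bound: "\<And>x. square_summable x \<Longrightarrow> cmod (L x) \<le> K * sqrt (\<Sum>n. (cmod (x n))\<^sup>2)"
  obtains h where "square_summable h"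
    and "\<And>x. square_summable x \<Longrightarrow> L x = (\<Sum>n. x n * cnj (h n))"
proof -
  define e where "e m = (\<lambda>n. if n = m then 1 else 0 :: complex)" for m :: nat
  define h where "h m = cnj (L (e m))" for m
  define trunc where "trunc N x = (\<lambda>n. if n < N then x n else 0 :: complex)" for N :: nat and x
  have e: "square_summable (e m)" for m
    by (rule square_summable_finite_support[of "Suc m"]) (simp add: e_def)
  have trunc: "square_summable (trunc N x)" for N x
    by (rule square_summable_finite_support[of N]) (simp add: trunc_def)
  have L_trunc: "L (trunc N x) = (\<Sum>n<N. x n * cnj (h n))" for N x
  proof (induction N)
    case 0
    show ?case
      using scale[OF trunc, of 0 0 x] by (simp add: trunc_def)
  next
    case (Suc N)
    have "trunc (Suc N) x = (\<lambda>n. trunc N x n + x N * e N n)"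
      by (auto simp: trunc_def e_def less_Suc_eq)
    then have "L (trunc (Suc N) x) = L (trunc N x) + x N * L (e N)"
      by (simp add: add scale trunc e square_summable_scale)
    then show ?case
      by (simp add: Suc h_def)
  qed
  have norm_trunc: "(\<Sum>n. (cmod (trunc N x n))\<^sup>2) = (\<Sum>n<N. (cmod (x n))\<^sup>2)" for N x
    by (subst suminf_finite[of "{..<N}"]) (auto simp: trunc_def)
  \<comment> \<open>Applying the bound to the truncation of \<open>h\<close> itself gives
    \<open>?S \<le> K * sqrt ?S\<close>. The sign of \<open>K\<close> is not known, so
    \<open>sqrt ?S\<close> is compared with its absolute value.\<close>
  have partial: "(\<Sum>n<N. (cmod (h n))\<^sup>2) \<le> K\<^sup>2" for N
  proof -
    let ?S = "\<Sum>n<N. (cmod (h n))\<^sup>2"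
    have nonneg: "?S \<ge> 0"
      by (simp add: sum_nonneg)
    have "L (trunc N h) = of_real ?S"
      by (simp add: L_trunc flip: complex_norm_square)
    then have "cmod (L (trunc N h)) = ?S"
      using nonneg by (simp only: norm_of_real abs_of_nonneg)
    then have "?S \<le> K * sqrt ?S"
      using bound[OF trunc, of N h] by (simp add: norm_trunc)
    then have "sqrt ?S * sqrt ?S \<le> K * sqrt ?S"
      using nonneg by simp
    then have "sqrt ?S \<le> \<bar>K\<bar>"
      using nonneg
      by (smt (verit) mult_right_le_imp_le mult_right_mono real_sqrt_ge_zero real_sqrt_eq_zero_cancel_iff)
    then show ?thesis
      using nonneg by (metis abs_ge_zero power2_abs power_mono real_sqrt_ge_zero real_sqrt_pow2)
  qed
  have h: "square_summable h"
    unfolding square_summable_def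
    by (rule summableI_nonneg_bounded[OF _ partial]) simp
  have "L x = (\<Sum>n. x n * cnj (h n))" if x: "square_summable x" for x
  proof (rule LIMSEQ_unique)
    show "(\<lambda>N. L (trunc N x)) \<longlonglongrightarrow> (\<Sum>n. x n * cnj (h n))"
      unfolding L_trunc by (intro summable_LIMSEQ square_summable_mult_cnj x h)
    \<comment> \<open>The difference is written with \<open>(-1) *\<close> so that
      \<open>add\<close> and \<open>scale\<close> apply. Its squared norm is the remainder of a
      convergent series and tends to 0.\<close>
    define tail where "tail N = (\<lambda>n. x n + (-1) * trunc N x n)" for N
    have tail: "square_summable (tail N)" for N
      unfolding tail_def by (intro square_summable_add square_summable_scale x trunc)
    have "L (tail N) = L x - L (trunc N x)" for N
      unfolding tail_def
      by (subst add, rule x, intro square_summable_scale trunc, subst scale, rule trunc) simp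
    moreover have "(\<Sum>n. (cmod (tail N n))\<^sup>2) = (\<Sum>n. (cmod (x n))\<^sup>2) - (\<Sum>n<N. (cmod (x n))\<^sup>2)" for N
    proof -
      have "(\<lambda>n. (cmod (tail N n))\<^sup>2) = (\<lambda>n. (cmod (x n))\<^sup>2 - (cmod (trunc N x n))\<^sup>2)"
        by (auto simp: tail_def trunc_def)
      then show ?thesis
        using suminf_diff[of "\<lambda>n. (cmod (x n))\<^sup>2" "\<lambda>n. (cmod (trunc N x n))\<^sup>2"] x trunc[of N x]
        by (simp add: norm_trunc square_summable_def)
    qed
    ultimately have le: "cmod (L x - L (trunc N x)) \<le>
        K * sqrt ((\<Sum>n. (cmod (x n))\<^sup>2) - (\<Sum>n<N. (cmod (x n))\<^sup>2))" for N
      using bound[OF tail, of N] by simp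
    have "(\<lambda>N. K * sqrt ((\<Sum>n. (cmod (x n))\<^sup>2) - (\<Sum>n<N. (cmod (x n))\<^sup>2))) \<longlonglongrightarrow>
        K * sqrt ((\<Sum>n. (cmod (x n))\<^sup>2) - (\<Sum>n. (cmod (x n))\<^sup>2))"
      using x unfolding square_summable_def by (intro tendsto_intros summable_LIMSEQ)
    then have "(\<lambda>N. L x - L (trunc N x)) \<longlonglongrightarrow> 0"
      by (intro Lim_null_comparison[OF always_eventually[OF allI[OF le]]]) simp
    then show "(\<lambda>N. L (trunc N x)) \<longlonglongrightarrow> L x"
      using tendsto_diff[OF tendsto_const[of "L x"], of _ 0 sequentially] by force
  qed
  then show ?thesis
    using h that by blast
qed

subsection \<open>Maclaurin coefficients and circular means\<close>

lemma maclaurin_coeff_sums: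
  assumes "F holomorphic_on ball 0 1" "z \<in> ball 0 1"
  shows "(\<lambda>n. maclaurin_coeff F n * z ^ n) sums F z"
  using holomorphic_power_series[OF assms] by (simp add: maclaurin_coeff_def)

text \<open>Uniqueness of power series, taken from formal power series. It reduces later
  computations of coefficients to statements about sums.\<close>

lemma maclaurin_coeff_eqI:
  assumes sums: "\<And>z. z \<in> ball 0 1 \<Longrightarrow> (\<lambda>n. x n * z ^ n) sums F z"
  shows "maclaurin_coeff F = x"
proof -
  have "conv_radius x \<ge> 1"
    by (intro conv_radius_geI_ex' sums_summable[OF sums]) (simp add: one_ereal_def)
  then have "fps_conv_radius (Abs_fps x) > 0"
    by (simp add: fps_conv_radius_def less_le_trans[of 0 1])
  moreover have "eventually (\<lambda>z. eval_fps (Abs_fps x) z = F z) (nhds 0)"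
    by (rule eventually_mono[OF eventually_nhds_in_open[of "ball 0 1"]])
       (auto simp: eval_fps_def sums_unique[OF sums])
  ultimately have "F has_fps_expansion Abs_fps x"
    by (simp add: has_fps_expansion_def)
  from fps_nth_fps_expansion[OF this] show ?thesis
    by (simp add: maclaurin_coeff_def fun_eq_iff)
qed

lemma maclaurin_coeff_cong:
  assumes "F holomorphic_on ball 0 1" "\<And>z. z \<in> ball 0 1 \<Longrightarrow> F z = G z"
  shows "maclaurin_coeff F = maclaurin_coeff G"
  using maclaurin_coeff_sums[OF assms(1)] assms(2) by (intro maclaurin_coeff_eqI[symmetric]) simp

lemma maclaurin_coeff_add:
  assumes "F holomorphic_on ball 0 1" "G holomorphic_on ball 0 1"
  shows "maclaurin_coeff (\<lambda>z. F z + G z) = (\<lambda>n. maclaurin_coeff F n + maclaurin_coeff G n)"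
  using assms
  by (intro maclaurin_coeff_eqI) (auto simp: algebra_simps intro!: sums_add maclaurin_coeff_sums)

lemma maclaurin_coeff_scale:
  assumes "F holomorphic_on ball 0 1"
  shows "maclaurin_coeff (\<lambda>z. k * F z) = (\<lambda>n. k * maclaurin_coeff F n)"
  using assms
  by (intro maclaurin_coeff_eqI) (auto simp: mult.assoc intro!: sums_mult maclaurin_coeff_sums)

lemma one_minus_mult_nonzero:
  fixes u v :: complex
  assumes "cmod u < 1" "cmod v < 1"
  shows "1 - u * v \<noteq> 0"
proof
  assume "1 - u * v = 0"
  then have "cmod u * cmod v = 1"
    by (metis eq_iff_diff_eq_0 norm_mult norm_one)
  moreover have "cmod u * cmod v < 1 * 1"
    using assms by (intro mult_strict_mono') auto
  ultimately show False
    by simp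
qed

lemma maclaurin_coeff_geometric:
  assumes "cmod v < 1"
  shows "maclaurin_coeff (\<lambda>z. k / (1 - v * z)) = (\<lambda>n. k * v ^ n)"
proof (rule maclaurin_coeff_eqI)
  fix z :: complex assume "z \<in> ball 0 1"
  then have "cmod (v * z) < 1"
    using assms mult_strict_mono'[of "cmod v" 1 "cmod z" 1] by (simp add: norm_mult)
  from sums_mult[OF geometric_sums[OF this], of k]
  show "(\<lambda>n. k * v ^ n * z ^ n) sums (k / (1 - v * z))"
    by (simp add: power_mult_distrib mult.assoc)
qed

text \<open>The series converges at z because its terms pair \<open>x\<close> with the geometric
  sequence of \<open>cnj z\<close>, and both are square-summable.\<close>

lemma square_summable_holomorphic:
  assumes "square_summable x"
  obtains F where "F holomorphic_on ball 0 1" "maclaurin_coeff F = x"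
proof -
  define F where "F z = (\<Sum>n. x n * z ^ n)" for z
  have sums: "(\<lambda>n. x n * z ^ n) sums F z" if "z \<in> ball 0 1" for z
    using square_summable_mult_cnj[OF assms square_summable_geometric[of "cnj z"]] that
    by (simp add: F_def summable_sums)
  have "F holomorphic_on ball 0 1"
    by (rule power_series_holomorphic[of 0 1 x]) (use sums in simp)
  with maclaurin_coeff_eqI[of x F] sums that show ?thesis
    by blast
qed

text \<open>Cauchy's formula for the n-th derivative. On the circle
  \<open>\<gamma> * cnj \<gamma> = r\<^sup>2\<close>, so multiplying by \<open>r ^ (2 * n)\<close>
  turns the negative power of \<gamma> into a conjugate.\<close>

lemma circle_mean_maclaurin_coeff:
  assumes F: "F holomorphic_on ball 0 1" and r: "0 < r" "r < 1"
  shows "((\<lambda>t. F (circlepath 0 r t) * cnj (circlepath 0 r t ^ n)) has_integral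
          maclaurin_coeff F n * of_real (r ^ (2 * n))) {0..1}"
proof -
  let ?\<gamma> = "circlepath 0 r"
  have sub: "cball 0 r \<subseteq> ball (0::complex) 1"
    using r by auto
  have "((\<lambda>u. F u / (u - 0) ^ Suc n) has_contour_integral
      (2 * pi * \<i>) / fact n * (deriv ^^ n) F 0) ?\<gamma>"
    using F r sub holomorphic_on_subset[OF F] holomorphic_on_imp_continuous_on
    by (intro Cauchy_has_contour_integral_higher_derivative_circlepath)
       (auto intro!: holomorphic_on_subset[OF F] holomorphic_on_imp_continuous_on)
  then have "((\<lambda>t. F (?\<gamma> t) / ?\<gamma> t ^ Suc n * (2 * pi * \<i> * ?\<gamma> t)) has_integral
      2 * pi * \<i> * maclaurin_coeff F n) {0..1}"
    unfolding has_contour_integral_def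
    by (rule has_integral_eq[rotated, OF has_integral_eq_rhs])
       (simp_all add: vector_derivative_circlepath01 maclaurin_coeff_def, simp add: circlepath)
  from has_integral_mult_right[OF this, of "of_real (r ^ (2 * n)) / (2 * pi * \<i>)"]
  have "((\<lambda>t. of_real (r ^ (2 * n)) / (2 * pi * \<i>) * (F (?\<gamma> t) / ?\<gamma> t ^ Suc n * (2 * pi * \<i> * ?\<gamma> t)))
      has_integral maclaurin_coeff F n * of_real (r ^ (2 * n))) {0..1}"
    by (simp add: mult.commute)
  moreover have "of_real (r ^ (2 * n)) / (2 * pi * \<i>) * (F (?\<gamma> t) / ?\<gamma> t ^ Suc n * (2 * pi * \<i> * ?\<gamma> t)) =
      F (?\<gamma> t) * cnj (?\<gamma> t ^ n)" for t
  proof -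
    have nz: "?\<gamma> t \<noteq> 0"
      using r by (simp add: circlepath)
    have "cmod (?\<gamma> t) = r"
      using r by (simp add: circlepath norm_mult)
    then have "?\<gamma> t * cnj (?\<gamma> t) = of_real (r\<^sup>2)"
      using complex_norm_square[of "?\<gamma> t"] by simp
    then have "of_real (r ^ (2 * n)) = ?\<gamma> t ^ n * cnj (?\<gamma> t ^ n)"
      by (simp add: power_mult of_real_power flip: power_mult_distrib)
    then show ?thesis
      using nz by (simp add: field_simps)
  qed
  ultimately show ?thesis
    by simp
qed

text \<open>In \<open>F * cnj F\<close> only the conjugated factor is expanded. Uniform convergence
  on the circle allows integration term by term, and each term is a mean from
  \<open>circle_mean_maclaurin_coeff\<close>.\<close>

lemma Parseval_circle:
  assumes F: "F holomorphic_on ball 0 1" and r: "0 < r" "r < 1"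
  shows "(\<lambda>n. (cmod (maclaurin_coeff F n))\<^sup>2 * r ^ (2 * n)) sums
         integral {0..1} (\<lambda>t. (cmod (F (circlepath 0 r t)))\<^sup>2)"
proof -
  let ?\<gamma> = "circlepath 0 r" and ?x = "maclaurin_coeff F"
  have \<gamma>: "?\<gamma> t \<in> cball 0 r" "?\<gamma> t \<in> ball 0 1" for t
    using r by (simp_all add: circlepath norm_mult)
  have cont_\<gamma>: "continuous_on {0..1} ?\<gamma>"
    using path_circlepath by (simp only: path_def)
  have cont_F: "continuous_on {0..1} (\<lambda>t. F (?\<gamma> t))"
    using \<gamma> by (intro continuous_on_compose2[OF holomorphic_on_imp_continuous_on[OF F] cont_\<gamma>]) auto
  have "conv_radius ?x \<ge> 1"
    by (intro conv_radius_geI_ex' sums_summable[OF maclaurin_coeff_sums[OF F]]) (simp add: one_ereal_def)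
  then have "ereal r < conv_radius ?x"
    using r by (meson ereal_less(3) less_le_trans)
  from powser_uniform_limit[OF this, of 0]
  have "uniform_limit (cball 0 r) (\<lambda>N z. \<Sum>n<N. ?x n * z ^ n) F sequentially"
    by (rule uniform_limit_cong'[THEN iffD1, rotated 2])
       (use r in \<open>auto intro!: sums_unique[OF maclaurin_coeff_sums[OF F], symmetric]\<close>)
  then have "uniform_limit {0..1} (\<lambda>N t. \<Sum>n<N. ?x n * ?\<gamma> t ^ n) (\<lambda>t. F (?\<gamma> t)) sequentially"
    using \<gamma> by (rule_tac uniform_limit_compose') auto
  then have "uniform_limit {0..1} (\<lambda>N t. cnj (\<Sum>n<N. ?x n * ?\<gamma> t ^ n)) (\<lambda>t. cnj (F (?\<gamma> t))) sequentially"
    by (rule bounded_linear_uniform_limit_intros)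
  moreover have "bounded ((\<lambda>t. F (?\<gamma> t)) ` {0..1})"
    by (intro compact_imp_bounded compact_continuous_image cont_F) simp
  ultimately have lim: "uniform_limit {0..1} (\<lambda>N t. F (?\<gamma> t) * cnj (\<Sum>n<N. ?x n * ?\<gamma> t ^ n))
      (\<lambda>t. F (?\<gamma> t) * cnj (F (?\<gamma> t))) sequentially"
    by (intro uniform_lim_mult uniform_limit_const)
       (auto simp: bounded_iff)
  have "continuous_on {0..1} (\<lambda>t. F (?\<gamma> t) * cnj (\<Sum>n<N. ?x n * ?\<gamma> t ^ n))" for N
    by (intro continuous_intros cont_F cont_\<gamma>)
  from uniform_limit_integral[OF lim this] obtain I J where
    I: "\<And>N. ((\<lambda>t. F (?\<gamma> t) * cnj (\<Sum>n<N. ?x n * ?\<gamma> t ^ n)) has_integral I N) {0..1}"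
    and J: "((\<lambda>t. F (?\<gamma> t) * cnj (F (?\<gamma> t))) has_integral J) {0..1}"
    and IJ: "I \<longlonglongrightarrow> J"
    by auto
  have "I N = of_real (\<Sum>n<N. (cmod (?x n))\<^sup>2 * r ^ (2 * n))" for N
  proof -
    have int: "((\<lambda>t. \<Sum>n<N. cnj (?x n) * (F (?\<gamma> t) * cnj (?\<gamma> t ^ n))) has_integral
        (\<Sum>n<N. cnj (?x n) * (?x n * of_real (r ^ (2 * n))))) {0..1}"
      by (intro has_integral_sum has_integral_mult_right circle_mean_maclaurin_coeff assms) auto
    have integrand: "(\<lambda>t. \<Sum>n<N. cnj (?x n) * (F (?\<gamma> t) * cnj (?\<gamma> t ^ n))) =
        (\<lambda>t. F (?\<gamma> t) * cnj (\<Sum>n<N. ?x n * ?\<gamma> t ^ n))"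
      by (simp add: sum_distrib_left algebra_simps)
    have "cnj (?x n) * (?x n * of_real (r ^ (2 * n))) = of_real ((cmod (?x n))\<^sup>2 * r ^ (2 * n))" for n
      by (simp add: complex_norm_square del: of_real_power)
    then show ?thesis
      using has_integral_unique[OF I[of N] int[unfolded integrand]] by (simp only: of_real_sum)
  qed
  then have "I = (\<lambda>N. \<Sum>n<N. complex_of_real ((cmod (?x n))\<^sup>2 * r ^ (2 * n)))"
    by (simp only: fun_eq_iff of_real_sum) simp
  with IJ have "(\<lambda>n. complex_of_real ((cmod (?x n))\<^sup>2 * r ^ (2 * n))) sums J"
    by (simp only: sums_def)
  from sums_Re[OF this]
  have "(\<lambda>n. (cmod (?x n))\<^sup>2 * r ^ (2 * n)) sums Re J"
    by (simp only: Re_complex_of_real)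
  moreover have "((\<lambda>t. complex_of_real ((cmod (F (?\<gamma> t)))\<^sup>2)) has_integral J) {0..1}"
    using J by (simp only: complex_norm_square)
  from has_integral_Re[OF this]
  have "((\<lambda>t. (cmod (F (?\<gamma> t)))\<^sup>2) has_integral Re J) {0..1}"
    by (simp only: Re_complex_of_real)
  ultimately show ?thesis
    by (simp only: integral_unique)
qed

text \<open>The factor \<open>r\<close> is the speed of the circle path divided by 2 pi, as it
  occurs in the arc-length means. In Parseval's formula \<open>r ^ (2 * n) \<le> 1\<close> gives one
  direction, and r tending to 1 gives the other.\<close>

lemma square_summable_iff_circle_means:
  assumes F: "F holomorphic_on ball 0 1"
  shows "square_summable (maclaurin_coeff F) \<longleftrightarrow>
    bdd_above ((\<lambda>r. r * integral {0..1} (\<lambda>t. (cmod (F (circlepath 0 r t)))\<^sup>2)) ` {0<..<1})"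
    (is "?L \<longleftrightarrow> bdd_above (?m ` _)")
proof
  let ?x = "maclaurin_coeff F"
  note sums = Parseval_circle[OF F]
  {
    assume x: ?L
    show "bdd_above (?m ` {0<..<1})"
    proof (rule bdd_aboveI2)
      fix r :: real assume r: "r \<in> {0<..<1}"
      then have *: "(cmod (?x n))\<^sup>2 * r ^ (2 * n) \<le> (cmod (?x n))\<^sup>2" for n
        by (simp add: mult_left_le power_le_one)
      have "integral {0..1} (\<lambda>t. (cmod (F (circlepath 0 r t)))\<^sup>2) \<le> (\<Sum>n. (cmod (?x n))\<^sup>2)"
        by (rule sums_le[OF * sums]) (use x r in \<open>auto simp: square_summable_def summable_sums\<close>)
      moreover have "integral {0..1} (\<lambda>t. (cmod (F (circlepath 0 r t)))\<^sup>2) \<ge> 0"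
        by (rule Henstock_Kurzweil_Integration.integral_nonneg[of _ "{0..1}"] )
           (use F r in \<open>auto intro!: integrable_continuous_interval continuous_intros
             continuous_on_compose2[OF holomorphic_on_imp_continuous_on[OF F]]
             path_circlepath[unfolded path_def] simp: norm_mult circlepath\<close>)
      ultimately show "?m r \<le> (\<Sum>n. (cmod (?x n))\<^sup>2)"
        using r mult_left_le_one_le[of _ r] by (auto intro: order_trans)
    qed
  next
    assume "bdd_above (?m ` {0<..<1})"
    then obtain M where "\<forall>r\<in>{0<..<1}. ?m r \<le> M"
      unfolding bdd_above_def by auto
    then have M: "?m r \<le> M" if "0 < r" "r < 1" for r
      using that by simp
    have "(\<Sum>n<N. (cmod (?x n))\<^sup>2) \<le> M" for N
    proof -
      \<comment> \<open>The limit is taken in a finite sum, so no interchange of limits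
        arises.\<close>
      have "((\<lambda>r. r * (\<Sum>n<N. (cmod (?x n))\<^sup>2 * r ^ (2 * n))) \<longlongrightarrow>
          1 * (\<Sum>n<N. (cmod (?x n))\<^sup>2 * 1 ^ (2 * n))) (at_left 1)"
        by (intro tendsto_intros)
      moreover have "eventually (\<lambda>r::real. r \<in> {0<..<1}) (at_left 1)"
        by (rule eventually_at_leftI[of 0]) auto
      then have "eventually (\<lambda>r. r * (\<Sum>n<N. (cmod (?x n))\<^sup>2 * r ^ (2 * n)) \<le> M) (at_left 1)"
      proof eventually_elim
        case (elim r)
        then have r: "0 < r" "r < 1" by auto
        have "(\<Sum>n<N. (cmod (?x n))\<^sup>2 * r ^ (2 * n)) \<le> integral {0..1} (\<lambda>t. (cmod (F (circlepath 0 r t)))\<^sup>2)"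
          unfolding sums_unique[OF sums[OF r]]
          by (intro sum_le_suminf) (use r sums[OF r] in \<open>auto simp: sums_iff\<close>)
        then show ?case
          using M[OF r] r by (meson less_imp_le mult_left_mono order_trans)
      qed
      ultimately show ?thesis
        using tendsto_upperbound[of _ _ "at_left (1::real)" M] by simp
    qed
    then show ?L
      unfolding square_summable_def by (intro summableI_nonneg_bounded[where x = M]) auto
  }
qed

subsection \<open>The Hilbert space structure of Hardy--Smirnov spaces\<close>

locale hardy_smirnov_space =
  fixes \<tau> s :: "complex \<Rightarrow> complex" and \<Omega> :: "complex set"
  assumes riemann_map: "riemann_map \<tau> \<Omega>"
    and sqrt_deriv: "analytic_sqrt_deriv \<tau> s"
begin

abbreviation H :: "(complex \<Rightarrow> complex) set" where
  "H \<equiv> hardy_smirnov \<tau> \<Omega>"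

abbreviation ip :: "(complex \<Rightarrow> complex) \<Rightarrow> (complex \<Rightarrow> complex) \<Rightarrow> complex" where
  "ip \<equiv> hs_inner \<tau> s"

abbreviation V :: "(complex \<Rightarrow> complex) \<Rightarrow> complex \<Rightarrow> complex" where
  "V \<equiv> hs_V \<tau> s"

abbreviation adj :: "((complex \<Rightarrow> complex) \<Rightarrow> complex \<Rightarrow> complex) \<Rightarrow>
    (complex \<Rightarrow> complex) \<Rightarrow> complex \<Rightarrow> complex" where
  "adj \<equiv> hilbert_adjoint H ip"

definition \<sigma> :: "complex \<Rightarrow> complex" where
  "\<sigma> = inv_into (ball 0 1) \<tau>"

text \<open>Identifies the space with square-summable sequences; completeness enters only through
  this identification.\<close>

definition coeff :: "(complex \<Rightarrow> complex) \<Rightarrow> nat \<Rightarrow> complex" where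
  "coeff f = maclaurin_coeff (V f)"

text \<open>The preimage under \<open>V\<close> of the Szego kernel of the disc at
  \<open>\<sigma> w\<close>, divided by \<open>cnj (s (\<sigma> w))\<close> so that it reproduces
  values of f and not of \<open>V f\<close>.\<close>

definition kernel :: "complex \<Rightarrow> complex \<Rightarrow> complex" where
  "kernel w = (\<lambda>z. if z \<in> \<Omega>
     then 1 / (s (\<sigma> z) * cnj (s (\<sigma> w)) * (1 - cnj (\<sigma> w) * \<sigma> z)) else 0)"

section \<open>The Riemann map, its inverse and the square root of its derivative\<close>

lemma holomorphic_\<tau>: "\<tau> holomorphic_on ball 0 1"
  and image_\<tau>: "\<tau> ` ball 0 1 = \<Omega>"
  using riemann_map by (auto simp: riemann_map_def)

lemma \<tau>_in [simp]: "z \<in> ball 0 1 \<Longrightarrow> \<tau> z \<in> \<Omega>"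
  using image_\<tau> by blast

lemma inj_\<tau>: "inj_on \<tau> (ball 0 1)"
  using riemann_map unfolding riemann_map_def by (metis inj_on_inverseI)

lemma \<sigma>_\<tau> [simp]: "z \<in> ball 0 1 \<Longrightarrow> \<sigma> (\<tau> z) = z"
  by (simp add: \<sigma>_def inj_\<tau> inv_into_f_f)

lemma \<tau>_\<sigma> [simp]: "w \<in> \<Omega> \<Longrightarrow> \<tau> (\<sigma> w) = w"
  by (simp add: \<sigma>_def f_inv_into_f image_\<tau>)

lemma \<sigma>_in [simp]: "w \<in> \<Omega> \<Longrightarrow> \<sigma> w \<in> ball 0 1"
  unfolding \<sigma>_def by (rule inv_into_into) (simp add: image_\<tau>)

lemma norm_\<sigma> [simp]: "w \<in> \<Omega> \<Longrightarrow> cmod (\<sigma> w) < 1"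
  using \<sigma>_in by simp

lemma holomorphic_\<sigma>: "\<sigma> holomorphic_on \<Omega>"
proof -
  obtain \<rho> where \<rho>: "\<rho> holomorphic_on \<Omega>" "\<rho> ` \<Omega> = ball 0 1" "\<forall>w\<in>\<Omega>. \<tau> (\<rho> w) = w"
    using riemann_map unfolding riemann_map_def by blast
  have "\<rho> w = \<sigma> w" if "w \<in> \<Omega>" for w
    using \<rho> that by (metis \<sigma>_\<tau> imageI)
  then show ?thesis
    using \<rho>(1) holomorphic_transform by blast
qed

lemma holomorphic_s: "s holomorphic_on ball 0 1"
  and s_squared: "z \<in> ball 0 1 \<Longrightarrow> (s z)\<^sup>2 = deriv \<tau> z"
  using sqrt_deriv by (auto simp: analytic_sqrt_deriv_def)

text \<open>The derivative of an injective holomorphic map has no zeros.\<close>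

lemma s_nonzero: "z \<in> ball 0 1 \<Longrightarrow> s z \<noteq> 0"
  using s_squared holomorphic_injective_imp_regular[OF holomorphic_\<tau> open_ball inj_\<tau>] by force

lemma V_apply: "z \<in> ball 0 1 \<Longrightarrow> V f z = f (\<tau> z) * s z"
  by (simp add: hs_V_def)

lemma holomorphic_V:
  assumes "f holomorphic_on \<Omega>"
  shows "V f holomorphic_on ball 0 1"
proof -
  have "(\<lambda>z. f (\<tau> z) * s z) holomorphic_on ball 0 1"
    using holomorphic_on_compose_gen[OF holomorphic_\<tau> assms] image_\<tau>
    by (intro holomorphic_on_mult holomorphic_s) (simp add: o_def)
  then show ?thesis
    by (rule holomorphic_transform) (simp add: V_apply)
qed

text \<open>By the chain rule the speed of the image curve is 2 pi r times the square of
  \<open>cmod (s z)\<close>, and that square is absorbed into \<open>V f\<close>.\<close>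

lemma arclength_mean:
  assumes f: "f holomorphic_on \<Omega>" and r: "0 < r" "r < 1"
  shows "1 / (2 * pi) * arclength_integral (\<tau> \<circ> circlepath 0 r) (\<lambda>w. (cmod (f w))\<^sup>2) =
    r * integral {0..1} (\<lambda>t. (cmod (V f (circlepath 0 r t)))\<^sup>2)"
proof -
  let ?\<gamma> = "circlepath 0 r"
  have "arclength_integral (\<tau> \<circ> ?\<gamma>) (\<lambda>w. (cmod (f w))\<^sup>2) =
      integral {0..1} (\<lambda>t. 2 * pi * r * (cmod (V f (?\<gamma> t)))\<^sup>2)"
    unfolding arclength_integral_def
  proof (rule Henstock_Kurzweil_Integration.integral_cong)
    fix t :: real assume t: "t \<in> {0..1}"
    let ?D = "2 * pi * \<i> * r * exp (2 * of_real pi * \<i> * t)"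
    have \<gamma>: "?\<gamma> t \<in> ball 0 1"
      using r by (simp add: circlepath norm_mult)
    then have "(\<tau> has_field_derivative deriv \<tau> (?\<gamma> t)) (at (?\<gamma> t))"
      using holomorphic_\<tau> by (simp add: holomorphic_derivI)
    then have "(\<tau> \<circ> ?\<gamma> has_vector_derivative ?D * deriv \<tau> (?\<gamma> t)) (at t within {0..1})"
      by (intro field_vector_diff_chain_within has_vector_derivative_circlepath)
         (rule has_field_derivative_at_within)
    then have "vector_derivative (\<tau> \<circ> ?\<gamma>) (at t within {0..1}) = ?D * (s (?\<gamma> t))\<^sup>2"
      using t \<gamma> by (simp add: vector_derivative_within_closed_interval s_squared)
    then show "(cmod (f ((\<tau> \<circ> ?\<gamma>) t)))\<^sup>2 * norm (vector_derivative (\<tau> \<circ> ?\<gamma>) (at t within {0..1})) =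
        2 * pi * r * (cmod (V f (?\<gamma> t)))\<^sup>2"
      using \<gamma> r by (simp add: V_apply norm_mult norm_power power_mult_distrib)
  qed
  then show ?thesis
    by simp
qed

text \<open>Replaces the arc-length means by square summability; membership is decided through this
  form from here on.\<close>

lemma H_iff:
  "f \<in> H \<longleftrightarrow> f holomorphic_on \<Omega> \<and> (\<forall>w. w \<notin> \<Omega> \<longrightarrow> f w = 0) \<and> square_summable (coeff f)"
proof (cases "f holomorphic_on \<Omega>")
  case True
  have "(\<lambda>r. 1 / (2 * pi) * arclength_integral (\<tau> \<circ> circlepath 0 r) (\<lambda>w. (cmod (f w))\<^sup>2)) ` {0<..<1} =
      (\<lambda>r. r * integral {0..1} (\<lambda>t. (cmod (V f (circlepath 0 r t)))\<^sup>2)) ` {0<..<1}"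
    by (rule image_cong) (simp_all only: greaterThanLessThan_iff arclength_mean[OF True])
  then show ?thesis
    using True square_summable_iff_circle_means[OF holomorphic_V[OF True]]
    by (simp only: hardy_smirnov_def coeff_def mem_Collect_eq)
qed (simp add: hardy_smirnov_def)

lemma H_holomorphic: "f \<in> H \<Longrightarrow> f holomorphic_on \<Omega>"
  and H_outside: "f \<in> H \<Longrightarrow> w \<notin> \<Omega> \<Longrightarrow> f w = 0"
  and H_coeff: "f \<in> H \<Longrightarrow> square_summable (coeff f)"
  by (auto simp: H_iff)

lemma H_eqI: "f \<in> H \<Longrightarrow> g \<in> H \<Longrightarrow> (\<And>w. w \<in> \<Omega> \<Longrightarrow> f w = g w) \<Longrightarrow> f = g"
  using H_outside by (metis ext)

lemma V_inject:
  assumes "f \<in> H" "g \<in> H" "\<And>z. z \<in> ball 0 1 \<Longrightarrow> V f z = V g z"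
  shows "f = g"
proof (rule H_eqI[OF assms(1,2)])
  fix w assume "w \<in> \<Omega>"
  then show "f w = g w"
    using assms(3)[of "\<sigma> w"] s_nonzero[of "\<sigma> w"] by (simp add: V_apply)
qed

lemma coeff_inject:
  assumes "f \<in> H" "g \<in> H" "coeff f = coeff g"
  shows "f = g"
proof (rule V_inject[OF assms(1,2)])
  fix z :: complex assume z: "z \<in> ball 0 1"
  have "(\<lambda>n. coeff f n * z ^ n) sums V f z" if "f \<in> H" for f
    using that z unfolding coeff_def by (intro maclaurin_coeff_sums holomorphic_V H_holomorphic)
  then show "V f z = V g z"
    using assms sums_unique2 by metis
qed

text \<open>The inverse of \<open>V\<close>, composition with \<sigma> and division by
  \<open>s\<close>, is applied to the disc function with coefficients \<open>x\<close>.\<close>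

lemma coeff_surj:
  assumes "square_summable x"
  obtains f where "f \<in> H" "coeff f = x"
proof -
  obtain F where F: "F holomorphic_on ball 0 1" "maclaurin_coeff F = x"
    using square_summable_holomorphic[OF assms] .
  define f where "f w = (if w \<in> \<Omega> then F (\<sigma> w) / s (\<sigma> w) else 0)" for w
  have sub: "\<sigma> ` \<Omega> \<subseteq> ball 0 1"
    using \<sigma>_in by blast
  have "(\<lambda>w. F (\<sigma> w) / s (\<sigma> w)) holomorphic_on \<Omega>"
    using holomorphic_on_compose_gen[OF holomorphic_\<sigma> F(1) sub]
      holomorphic_on_compose_gen[OF holomorphic_\<sigma> holomorphic_s sub] s_nonzero
    by (intro holomorphic_on_divide) (auto simp: o_def)
  then have f: "f holomorphic_on \<Omega>"
    by (rule holomorphic_transform) (simp add: f_def)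
  have "coeff f = x"
    using F maclaurin_coeff_cong[OF F(1), of "V f"] s_nonzero
    by (simp add: coeff_def V_apply f_def)
  moreover have "f \<in> H"
    using f assms calculation by (simp add: H_iff f_def)
  ultimately show ?thesis
    using that by blast
qed

lemma coeff_add:
  assumes "f \<in> H" "g \<in> H"
  shows "coeff (\<lambda>w. f w + g w) = (\<lambda>n. coeff f n + coeff g n)"
proof -
  have "V (\<lambda>w. f w + g w) = (\<lambda>z. V f z + V g z)"
    by (auto simp: hs_V_def algebra_simps)
  then show ?thesis
    using assms by (simp add: coeff_def maclaurin_coeff_add holomorphic_V H_holomorphic)
qed

lemma coeff_scale:
  assumes "f \<in> H"
  shows "coeff (\<lambda>w. k * f w) = (\<lambda>n. k * coeff f n)"
proof -
  have "V (\<lambda>w. k * f w) = (\<lambda>z. k * V f z)"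
    by (auto simp: hs_V_def)
  then show ?thesis
    using assms by (simp add: coeff_def maclaurin_coeff_scale holomorphic_V H_holomorphic)
qed

lemma H_add: "f \<in> H \<Longrightarrow> g \<in> H \<Longrightarrow> (\<lambda>w. f w + g w) \<in> H"
  by (simp add: H_iff[of "\<lambda>w. f w + g w"] coeff_add H_coeff H_outside H_holomorphic
      holomorphic_on_add square_summable_add)

lemma H_scale: "f \<in> H \<Longrightarrow> (\<lambda>w. k * f w) \<in> H"
  by (simp add: H_iff[of "\<lambda>w. k * f w"] coeff_scale H_coeff H_outside H_holomorphic
      holomorphic_on_mult square_summable_scale)

section \<open>The inner product in terms of coefficients\<close>

lemma ip_coeff: "ip f g = (\<Sum>n. coeff f n * cnj (coeff g n))"
  by (simp add: hs_inner_def hardy_inner_def coeff_def)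

lemma ip_add_left:
  assumes "f \<in> H" "g \<in> H" "h \<in> H"
  shows "ip (\<lambda>w. f w + g w) h = ip f h + ip g h"
  using assms by (simp add: ip_coeff coeff_add distrib_right suminf_add square_summable_mult_cnj H_coeff)

lemma ip_scale_left:
  assumes "f \<in> H" "h \<in> H"
  shows "ip (\<lambda>w. k * f w) h = k * ip f h"
  using assms by (simp add: ip_coeff coeff_scale mult.assoc suminf_mult square_summable_mult_cnj H_coeff)

lemma ip_commute:
  assumes "f \<in> H" "g \<in> H"
  shows "ip g f = cnj (ip f g)"
proof -
  have "(\<lambda>n. coeff f n * cnj (coeff g n)) sums ip f g"
    unfolding ip_coeff by (intro summable_sums square_summable_mult_cnj H_coeff assms)
  then have "(\<lambda>n. cnj (coeff f n * cnj (coeff g n))) sums cnj (ip f g)"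
    by (simp only: sums_cnj)
  then show ?thesis
    by (simp add: ip_coeff[of g f] sums_iff mult.commute)
qed

lemma ip_norm_coeff:
  assumes "f \<in> H"
  shows "ip_norm ip f = sqrt (\<Sum>n. (cmod (coeff f n))\<^sup>2)"
proof -
  have "(\<lambda>n. complex_of_real ((cmod (coeff f n))\<^sup>2)) sums of_real (\<Sum>n. (cmod (coeff f n))\<^sup>2)"
    using H_coeff[OF assms] by (simp only: sums_of_real_iff square_summable_def summable_sums)
  then have "ip f f = of_real (\<Sum>n. (cmod (coeff f n))\<^sup>2)"
    by (simp only: ip_coeff complex_norm_square sums_iff)
  then show ?thesis
    by (simp add: ip_norm_def)
qed

lemma Cauchy_Schwarz_H:
  assumes "f \<in> H" "g \<in> H"
  shows "cmod (ip f g) \<le> ip_norm ip f * ip_norm ip g"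
  using assms l2_Cauchy_Schwarz[of "coeff f" "coeff g"]
  by (simp add: ip_norm_coeff ip_coeff H_coeff)

text \<open>\<open>V\<close> sends the kernel to a geometric series with ratio
  \<open>cnj (\<sigma> w)\<close>.\<close>

lemma
  assumes w: "w \<in> \<Omega>"
  shows kernel_in_H [simp]: "kernel w \<in> H"
    and coeff_kernel: "coeff (kernel w) = (\<lambda>n. cnj (\<sigma> w) ^ n / cnj (s (\<sigma> w)))"
proof -
  have nz: "1 - cnj (\<sigma> w) * \<sigma> z \<noteq> 0" if "z \<in> \<Omega>" for z
    using w that by (intro one_minus_mult_nonzero) simp_all
  have sub: "\<sigma> ` \<Omega> \<subseteq> ball 0 1"
    using \<sigma>_in by blast
  have "(\<lambda>z. 1 / (s (\<sigma> z) * cnj (s (\<sigma> w)) * (1 - cnj (\<sigma> w) * \<sigma> z))) holomorphic_on \<Omega>"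
    using holomorphic_on_compose_gen[OF holomorphic_\<sigma> holomorphic_s sub] s_nonzero w nz
    by (intro holomorphic_intros holomorphic_\<sigma>) (auto simp: o_def)
  then have hol: "kernel w holomorphic_on \<Omega>"
    by (rule holomorphic_transform) (simp add: kernel_def)
  have "maclaurin_coeff (\<lambda>z. (1 / cnj (s (\<sigma> w))) / (1 - cnj (\<sigma> w) * z)) = coeff (kernel w)"
    unfolding coeff_def
  proof (rule maclaurin_coeff_cong)
    have nz': "1 - cnj (\<sigma> w) * z \<noteq> 0" if "z \<in> ball 0 1" for z
      using nz[of "\<tau> z"] that by simp
    then show "(\<lambda>z. (1 / cnj (s (\<sigma> w))) / (1 - cnj (\<sigma> w) * z)) holomorphic_on ball 0 1"
      by (intro holomorphic_intros) (use s_nonzero w in auto)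
    show "(1 / cnj (s (\<sigma> w))) / (1 - cnj (\<sigma> w) * z) = V (kernel w) z" if "z \<in> ball 0 1" for z
      using that s_nonzero[OF that] by (simp add: V_apply kernel_def)
  qed
  then show coeff: "coeff (kernel w) = (\<lambda>n. cnj (\<sigma> w) ^ n / cnj (s (\<sigma> w)))"
    using maclaurin_coeff_geometric[of "cnj (\<sigma> w)" "1 / cnj (s (\<sigma> w))"] norm_\<sigma>[OF w] by simp
  have "square_summable (\<lambda>n. (1 / cnj (s (\<sigma> w))) * cnj (\<sigma> w) ^ n)"
    using norm_\<sigma>[OF w] by (intro square_summable_scale square_summable_geometric) simp
  then show "kernel w \<in> H"
    using hol by (simp add: H_iff coeff) (simp add: kernel_def)
qed

lemma ip_kernel:
  assumes f: "f \<in> H" and w: "w \<in> \<Omega>"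
  shows "ip f (kernel w) = f w"
proof -
  have "(\<lambda>n. coeff f n * \<sigma> w ^ n) sums V f (\<sigma> w)"
    unfolding coeff_def using f w by (intro maclaurin_coeff_sums holomorphic_V H_holomorphic \<sigma>_in)
  from sums_divide[OF this, of "s (\<sigma> w)"]
  have "(\<lambda>n. coeff f n * cnj (coeff (kernel w) n)) sums f w"
    using w s_nonzero[of "\<sigma> w"] by (simp add: coeff_kernel V_apply)
  then show ?thesis
    by (simp add: ip_coeff sums_iff)
qed

lemma kernel_ip: "f \<in> H \<Longrightarrow> w \<in> \<Omega> \<Longrightarrow> ip (kernel w) f = cnj (f w)"
  by (simp add: ip_commute[of f "kernel w"] ip_kernel)

text \<open>Uniqueness in \<open>THE\<close> follows by testing against kernels, which recover point
  values.\<close>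

lemma adj_eqI:
  assumes "h \<in> H" "\<And>f. f \<in> H \<Longrightarrow> ip (T f) g = ip f h"
  shows "adj T g = h"
  unfolding hilbert_adjoint_def
proof (rule the_equality)
  fix h' assume h': "h' \<in> H \<and> (\<forall>f\<in>H. ip (T f) g = ip f h')"
  show "h' = h"
  proof (rule H_eqI)
    fix w assume w: "w \<in> \<Omega>"
    then have "ip (kernel w) h' = ip (kernel w) h"
      using assms h' by simp
    then show "h' w = h w"
      using assms h' w by (simp add: kernel_ip)
  qed (use assms h' in auto)
qed (use assms in auto)

lemma adj_works:
  assumes T: "bounded_operator H ip T" and g: "g \<in> H"
  shows "adj T g \<in> H" and "\<And>f. f \<in> H \<Longrightarrow> ip (T f) g = ip f (adj T g)"
proof -
  obtain K where K: "\<And>f. f \<in> H \<Longrightarrow> ip_norm ip (T f) \<le> K * ip_norm ip f"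
    using T unfolding bounded_operator_def by blast
  have T_H: "T f \<in> H" if "f \<in> H" for f
    using T that unfolding bounded_operator_def by blast
  \<comment> \<open>\<open>U\<close> is a chosen inverse of \<open>coeff\<close>; injectivity of
    \<open>coeff\<close> makes it linear, so that \<open>l2_Riesz\<close> applies to the functional
    \<open>L\<close>.\<close>
  define U where "U x = (SOME f. f \<in> H \<and> coeff f = x)" for x
  have U: "U x \<in> H \<and> coeff (U x) = x" if x: "square_summable x" for x
  proof -
    obtain f where "f \<in> H \<and> coeff f = x"
      using coeff_surj[OF x] by metis
    then show ?thesis
      unfolding U_def by (rule someI[of "\<lambda>f. f \<in> H \<and> coeff f = x"])
  qed
  have U_coeff: "U (coeff f) = f" if "f \<in> H" for f
    using U[OF H_coeff[OF that]] that coeff_inject by blast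
  define L where "L x = ip (T (U x)) g" for x
  obtain x where x: "square_summable x"
    and L: "\<And>y. square_summable y \<Longrightarrow> L y = (\<Sum>n. y n * cnj (x n))"
  proof (rule l2_Riesz[of L "K * ip_norm ip g"])
    fix y z assume yz: "square_summable y" "square_summable z"
    then have "U (\<lambda>n. y n + z n) = (\<lambda>w. U y w + U z w)"
      by (intro coeff_inject) (simp_all add: U H_add coeff_add square_summable_add)
    moreover have "T (\<lambda>w. U y w + U z w) = (\<lambda>w. T (U y) w + T (U z) w)"
      using T U yz unfolding bounded_operator_def by blast
    ultimately show "L (\<lambda>n. y n + z n) = L y + L z"
      using U yz by (simp add: L_def ip_add_left T_H g)
  next
    fix k y assume y: "square_summable y"
    then have "U (\<lambda>n. k * y n) = (\<lambda>w. k * U y w)"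
      by (intro coeff_inject) (simp_all add: U H_scale coeff_scale square_summable_scale)
    moreover have "T (\<lambda>w. k * U y w) = (\<lambda>w. k * T (U y) w)"
      using T U y unfolding bounded_operator_def by blast
    ultimately show "L (\<lambda>n. k * y n) = k * L y"
      using U y by (simp add: L_def ip_scale_left T_H g)
  next
    fix y assume "square_summable y"
    then have y: "U y \<in> H" "coeff (U y) = y"
      by (simp_all add: U)
    have "cmod (L y) \<le> ip_norm ip (T (U y)) * ip_norm ip g"
      unfolding L_def by (intro Cauchy_Schwarz_H T_H y g)
    also have "\<dots> \<le> K * ip_norm ip (U y) * ip_norm ip g"
      by (intro mult_right_mono K y) (simp add: ip_norm_coeff[OF g] suminf_nonneg
          H_coeff[OF g, unfolded square_summable_def])
    finally show "cmod (L y) \<le> K * ip_norm ip g * sqrt (\<Sum>n. (cmod (y n))\<^sup>2)"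
      using y by (simp add: ip_norm_coeff mult_ac)
  qed (rule that)
  obtain h where h: "h \<in> H" "coeff h = x"
    using coeff_surj[OF x] .
  have *: "ip (T f) g = ip f h" if "f \<in> H" for f
    using L[OF H_coeff[OF that]] by (simp add: L_def U_coeff that ip_coeff[of f h] h)
  with h adj_eqI show "adj T g \<in> H" "\<And>f. f \<in> H \<Longrightarrow> ip (T f) g = ip f (adj T g)"
    by simp_all
qed

lemma adj_apply:
  assumes "bounded_operator H ip T" "g \<in> H" "w \<in> \<Omega>"
  shows "adj T g w = cnj (ip (T (kernel w)) g)"
  using assms adj_works[OF assms(1,2)] by (simp add: kernel_ip)

section \<open>Composition operators and their action on kernels\<close>

lemma comp_op_apply: "w \<in> \<Omega> \<Longrightarrow> comp_op \<Omega> \<Phi> f w = f (\<Phi> w)"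
  by (simp add: comp_op_def)

text \<open>Paired with f, both sides give \<open>f (\<Phi> w)\<close> by the reproducing
  property.\<close>

lemma adj_comp_op_kernel:
  assumes "bounded_operator H ip (comp_op \<Omega> \<Phi>)" "analytic_self_map \<Omega> \<Phi>" "w \<in> \<Omega>"
  shows "adj (comp_op \<Omega> \<Phi>) (kernel w) = kernel (\<Phi> w)"
proof (rule adj_eqI)
  have \<Phi>: "\<Phi> w \<in> \<Omega>"
    using assms by (auto simp: analytic_self_map_def)
  then show "kernel (\<Phi> w) \<in> H"
    by simp
  fix f assume f: "f \<in> H"
  then have "comp_op \<Omega> \<Phi> f \<in> H"
    using assms unfolding bounded_operator_def by blast
  then show "ip (comp_op \<Omega> \<Phi> f) (kernel w) = ip f (kernel (\<Phi> w))"
    using f \<Phi> assms by (simp add: ip_kernel comp_op_apply)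
qed

lemma unitary_bounded: "unitary_operator H ip T \<Longrightarrow> bounded_operator H ip T"
  by (simp add: unitary_operator_def)

lemma unitary_inject:
  assumes "unitary_operator H ip T" "f \<in> H" "g \<in> H" "T f = T g"
  shows "f = g"
  using assms unfolding unitary_operator_def by metis

lemma unitary_surj:
  assumes "unitary_operator H ip T" "f \<in> H"
  obtains g where "g \<in> H" "T g = f"
  using assms adj_works(1)[OF unitary_bounded] unfolding unitary_operator_def by metis

text \<open>The operator undoes its adjoint, and the adjoint moves the kernel from w to
  \<open>\<Psi> w\<close>.\<close>

lemma unitary_comp_op_kernel:
  assumes "unitary_operator H ip (comp_op \<Omega> \<Psi>)" "analytic_self_map \<Omega> \<Psi>" "w \<in> \<Omega>"
  shows "comp_op \<Omega> \<Psi> (kernel (\<Psi> w)) = kernel w"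
  using assms adj_comp_op_kernel[OF unitary_bounded] unfolding unitary_operator_def
  by (metis kernel_in_H)

end

subsection \<open>Linear fractional Riemann maps with real coefficients\<close>

locale real_moebius_hardy_smirnov = hardy_smirnov_space +
  fixes a b c d :: real
  assumes det: "a * d - b * c \<noteq> 0"
    and \<tau>_eq: "\<And>z. z \<in> ball 0 1 \<Longrightarrow> \<tau> z = (of_real a * z + of_real b) / (of_real c * z + of_real d)"
begin

text \<open>The constant value of \<open>s z * (c * z + d)\<close>, read off at 0; it is a square
  root of the determinant.\<close>

definition \<kappa> :: complex where
  "\<kappa> = s 0 * of_real d"

definition \<epsilon> :: complex where
  "\<epsilon> = cnj \<kappa> / \<kappa>"

text \<open>With \<tau> substituted in both arguments this becomes 1 - u v, up to the denominators
  of \<tau> and a constant; see \<open>Q_\<tau>\<close>.\<close>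

definition Q :: "complex \<Rightarrow> complex \<Rightarrow> complex" where
  "Q x y = of_real (a\<^sup>2 - b\<^sup>2) + of_real (b * d - a * c) * (x + y) + of_real (c\<^sup>2 - d\<^sup>2) * x * y"

text \<open>\<open>J_Omega\<close> freed from the inverse of \<open>V\<close>. The sign \<epsilon>
  appears because \<open>J_disc\<close> also acts on the factor \<open>s\<close>.\<close>

definition J :: "(complex \<Rightarrow> complex) \<Rightarrow> complex \<Rightarrow> complex" where
  "J f = (\<lambda>w. \<epsilon> * cnj (f (cnj w)))"

text \<open>At a pole of \<open>\<tau>\<close> inside the disc the formula would give the value \<open>0\<close>;
  continuity of \<open>\<tau>\<close> excludes this.\<close>

lemma denom_nonzero:
  assumes z: "z \<in> ball 0 1"
  shows "of_real c * z + of_real d \<noteq> (0 :: complex)"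
proof
  assume 0: "of_real c * z + of_real d = (0 :: complex)"
  \<comment> \<open>Away from z the denominator is nonzero, so \<open>?g\<close> vanishes there and
    hence at z. The numerator then vanishes at z along with the denominator, against
    \<open>det\<close>.\<close>
  let ?g = "\<lambda>u. \<tau> u * (of_real c * u + of_real d) - (of_real a * u + of_real b)"
  have cd: "c \<noteq> 0"
    using 0 det by auto
  have "?g \<midarrow>z\<rightarrow> ?g z"
    using holomorphic_on_imp_continuous_on[OF holomorphic_\<tau>] z
    by (intro tendsto_intros) (simp add: continuous_on_eq_continuous_at isCont_def)
  moreover have "eventually (\<lambda>u. u \<in> ball 0 1 - {z}) (at z)"
    using z by (intro eventually_at_in_open) auto
  then have "eventually (\<lambda>u. 0 = ?g u) (at z)"
  proof eventually_elim
    case (elim u)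
    have "of_real c * u + of_real d \<noteq> (0::complex)"
    proof
      assume "of_real c * u + of_real d = (0::complex)"
      with 0 have "of_real c * u = of_real c * z"
        by (metis add_right_cancel)
      with cd elim show False
        by simp
    qed
    with elim show ?case
      by (simp add: \<tau>_eq)
  qed
  then have "?g \<midarrow>z\<rightarrow> 0"
    by (rule Lim_transform_eventually[OF tendsto_const])
  ultimately have "?g z = 0"
    by (intro LIM_unique)
  then have "of_real a * z + of_real b = (0::complex)"
    by (simp only: 0 mult_zero_right diff_0 neg_equal_0_iff_equal)
  then have "of_real (a * d - b * c) = (0::complex)"
    using 0 by (simp, algebra)
  with det show False
    by (simp only: of_real_eq_0_iff)
qed

lemma deriv_\<tau>:
  assumes z: "z \<in> ball 0 1"
  shows "deriv \<tau> z = of_real (a * d - b * c) / (of_real c * z + of_real d)\<^sup>2"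
proof -
  have "((\<lambda>z. (of_real a * z + of_real b) / (of_real c * z + of_real d)) has_field_derivative
      of_real (a * d - b * c) / (of_real c * z + of_real d)\<^sup>2) (at z)"
    using denom_nonzero[OF z]
    by (auto intro!: derivative_eq_intros simp: power2_eq_square algebra_simps)
  then have "(\<tau> has_field_derivative of_real (a * d - b * c) / (of_real c * z + of_real d)\<^sup>2) (at z)"
    by (rule has_field_derivative_transform_within_open[of _ _ _ "ball 0 1"])
       (use z \<tau>_eq in auto)
  then show ?thesis
    by (rule DERIV_imp_deriv)
qed

lemma \<kappa>_squared: "\<kappa>\<^sup>2 = of_real (a * d - b * c)"
  using s_squared[of 0] deriv_\<tau>[of 0] denom_nonzero[of 0]
  by (simp add: \<kappa>_def power_mult_distrib)

lemma \<kappa>_nonzero [simp]: "\<kappa> \<noteq> 0"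
  using \<kappa>_squared det by (metis of_real_eq_0_iff zero_power2)

text \<open>\<open>s z * (c * z + d)\<close> is continuous on the connected disc and takes only the
  values \<kappa> and -\<kappa>, so it is constant.\<close>

lemma s_eq:
  assumes z: "z \<in> ball 0 1"
  shows "s z = \<kappa> / (of_real c * z + of_real d)"
proof -
  let ?g = "\<lambda>z. s z * (of_real c * z + of_real d)"
  have "?g z = \<kappa> \<or> ?g z = - \<kappa>" if "z \<in> ball 0 1" for z
    unfolding power2_eq_iff[symmetric] \<kappa>_squared
    using denom_nonzero[OF that] by (simp add: power_mult_distrib s_squared[OF that] deriv_\<tau>[OF that])
  then have "?g ` ball 0 1 \<subseteq> {\<kappa>, - \<kappa>}"
    by blast
  then have "finite (?g ` ball 0 1)"
    by (rule finite_subset) simp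
  moreover have "continuous_on (ball 0 1) ?g"
    by (intro continuous_intros holomorphic_on_imp_continuous_on[OF holomorphic_s])
  ultimately have "?g constant_on ball 0 1"
    by (intro continuous_finite_range_constant) auto
  then have "?g z = ?g 0"
    unfolding constant_on_def using z by (metis centre_in_ball zero_less_one)
  then show ?thesis
    using denom_nonzero[OF z] by (simp add: \<kappa>_def field_simps)
qed

text \<open>The square of \<kappa> is real, so \<kappa> is real or purely imaginary.\<close>

lemma \<epsilon>_cases: "\<epsilon> = 1 \<or> \<epsilon> = -1"
proof -
  have "(cnj \<kappa>)\<^sup>2 = \<kappa>\<^sup>2"
    by (metis \<kappa>_squared complex_cnj_complex_of_real complex_cnj_power)
  then show ?thesis
    by (auto simp: \<epsilon>_def power2_eq_iff)
qed

lemma \<epsilon>_simps [simp]: "cnj \<epsilon> = \<epsilon>" "\<epsilon> * \<epsilon> = 1" "\<epsilon> * (\<epsilon> * z) = z" "\<epsilon> \<noteq> 0"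
  using \<epsilon>_cases by auto

lemma \<tau>_cnj: "z \<in> ball 0 1 \<Longrightarrow> \<tau> (cnj z) = cnj (\<tau> z)"
  by (simp add: \<tau>_eq)

lemma cnj_in [simp]: "cnj w \<in> \<Omega> \<longleftrightarrow> w \<in> \<Omega>"
proof -
  have "cnj w \<in> \<Omega>" if "w \<in> \<Omega>" for w
    using that \<tau>_cnj[of "\<sigma> w"] \<tau>_in[of "cnj (\<sigma> w)"] by simp
  then show ?thesis
    by (metis complex_cnj_cnj)
qed

lemma s_cnj: "z \<in> ball 0 1 \<Longrightarrow> cnj (s (cnj z)) = \<epsilon> * s z"
  by (simp add: s_eq \<epsilon>_def)

section \<open>The polynomial \<open>Q\<close> and the kernel\<close>

lemma cnj_Q: "cnj (Q x y) = Q (cnj x) (cnj y)"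
  by (simp add: Q_def)

lemma Q_\<tau>:
  assumes u: "u \<in> ball 0 1" and v: "v \<in> ball 0 1"
  shows "Q (\<tau> u) (\<tau> v) * ((of_real c * u + of_real d) * (of_real c * v + of_real d)) =
    of_real ((a * d - b * c)\<^sup>2) * (1 - u * v)"
proof -
  \<comment> \<open>Clearing denominators with generic letters leaves a polynomial identity for
    \<open>algebra\<close>.\<close>
  have "(A + B * (x / p + y / q) + C * (x / p) * (y / q)) * (p * q) =
      A * p * q + B * (x * q + y * p) + C * x * y"
    if "p \<noteq> 0" "q \<noteq> 0" for A B C x y p q :: complex
    using that by (simp add: field_simps)
  from this[OF denom_nonzero[OF u] denom_nonzero[OF v]] show ?thesis
    unfolding Q_def \<tau>_eq[OF u] \<tau>_eq[OF v]
    by (rule trans) (simp only: of_real_diff of_real_mult of_real_power, algebra)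
qed

text \<open>\<open>Q_\<tau>\<close> at \<open>\<sigma> z\<close> and
  \<open>cnj (\<sigma> w)\<close>. The leading constant depends on neither point, so comparing
  kernels amounts to comparing values of \<open>Q\<close>.\<close>

lemma
  assumes z: "z \<in> \<Omega>" and w: "w \<in> \<Omega>"
  shows Q_nonzero: "Q z (cnj w) \<noteq> 0"
    and kernel_eq: "kernel w z = \<kappa> ^ 4 / (\<kappa> * cnj \<kappa>) / Q z (cnj w)"
proof -
  let ?u = "\<sigma> z" and ?v = "cnj (\<sigma> w)"
  let ?p = "of_real c * ?u + of_real d" and ?q = "of_real c * ?v + of_real d"
  have uv: "?u \<in> ball 0 1" "?v \<in> ball 0 1"
    using z w by simp_all
  note nz = denom_nonzero[OF uv(1)] denom_nonzero[OF uv(2)]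
  have one: "1 - ?v * ?u \<noteq> 0"
    using z w by (intro one_minus_mult_nonzero) simp_all
  have "of_real ((a * d - b * c)\<^sup>2) = \<kappa> ^ 4"
    by (simp only: of_real_power \<kappa>_squared[symmetric] power_mult[symmetric]) simp
  moreover have "\<tau> ?v = cnj w"
    using w by (simp add: \<tau>_cnj)
  ultimately have Q: "Q z (cnj w) * (?p * ?q) = \<kappa> ^ 4 * (1 - ?v * ?u)"
    using Q_\<tau>[OF uv] z by (simp add: mult.commute)
  then show Q_nz: "Q z (cnj w) \<noteq> 0"
    using one nz by auto
  have "s ?u = \<kappa> / ?p" "cnj (s (\<sigma> w)) = cnj \<kappa> / ?q"
    using z w by (simp_all add: s_eq)
  then have "kernel w z = ?p * ?q / (\<kappa> * cnj \<kappa> * (1 - ?v * ?u))"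
    using z by (simp add: kernel_def)
  also have "\<dots> = \<kappa> ^ 4 / (\<kappa> * cnj \<kappa>) / Q z (cnj w)"
    using Q Q_nz one by (simp add: frac_eq_eq) (simp add: mult_ac)
  finally show "kernel w z = \<kappa> ^ 4 / (\<kappa> * cnj \<kappa>) / Q z (cnj w)" .
qed

lemma V_J:
  assumes z: "z \<in> ball 0 1"
  shows "V (J f) z = J_disc (V f) z"
  using z s_cnj[OF z] by (simp add: V_apply J_def J_disc_def \<tau>_cnj)

text \<open>\<open>J\<close> conjugates the coefficients, which preserves square
  summability.\<close>

lemma J_in_H [simp]:
  assumes f: "f \<in> H"
  shows "J f \<in> H"
proof -
  have "open \<Omega>"
    using open_mapping_thm3[OF holomorphic_\<tau> open_ball inj_\<tau>] by (simp add: image_\<tau>)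
  moreover have "w \<in> cnj ` \<Omega>" if "w \<in> \<Omega>" for w
    using that by (intro image_eqI[of _ _ "cnj w"]) simp_all
  then have "cnj ` \<Omega> = \<Omega>"
    by auto
  ultimately have "(cnj \<circ> f \<circ> cnj) holomorphic_on \<Omega>"
    using H_holomorphic[OF f] by (intro holomorphic_on_compose_cnj_cnj) simp_all
  then have hol: "J f holomorphic_on \<Omega>"
    unfolding J_def by (intro holomorphic_intros) (simp add: o_def)
  have "coeff (J f) = (\<lambda>n. cnj (coeff f n))"
    unfolding coeff_def
  proof (rule maclaurin_coeff_eqI)
    fix z :: complex assume z: "z \<in> ball 0 1"
    then have "(\<lambda>n. maclaurin_coeff (V f) n * cnj z ^ n) sums V f (cnj z)"
      using f by (intro maclaurin_coeff_sums holomorphic_V H_holomorphic) simp_all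
    then have "(\<lambda>n. cnj (maclaurin_coeff (V f) n * cnj z ^ n)) sums cnj (V f (cnj z))"
      by (simp only: sums_cnj)
    then show "(\<lambda>n. cnj (maclaurin_coeff (V f) n) * z ^ n) sums V (J f) z"
      by (simp add: V_J[OF z] J_disc_def)
  qed
  then show ?thesis
    using hol H_coeff[OF f] H_outside[OF f] by (simp add: H_iff square_summable_def) (simp add: J_def)
qed

lemma J_Omega_eq:
  assumes f: "f \<in> H"
  shows "J_Omega \<tau> s \<Omega> f = J f"
proof -
  have "J_disc (V f) = V (J f)"
    using V_J by (auto simp: fun_eq_iff hs_V_def J_disc_def)
  moreover have "inj_on V H"
    by (rule inj_onI) (auto intro: V_inject)
  ultimately show ?thesis
    using f by (simp add: J_Omega_def inv_into_f_f)
qed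

lemma J_J [simp]: "J (J f) = f"
  by (simp add: J_def)

text \<open>Conjugation removes the \<open>cnj\<close> from the second argument of \<open>Q\<close>,
  leaving an expression symmetric in z and w up to a constant factor.\<close>

lemma J_kernel_apply:
  assumes "z \<in> \<Omega>" "w \<in> \<Omega>"
  shows "J (kernel w) z = \<epsilon> * (cnj \<kappa> ^ 4 / (\<kappa> * cnj \<kappa>)) / Q z w"
  using assms by (simp add: J_def kernel_eq cnj_Q mult.commute)

text \<open>For \<open>c\<^sup>2 \<noteq> d\<^sup>2\<close> the point \<open>- shift\<close> is \<open>\<tau> (- c / d)\<close>, the centre of the disc \<open>\<Omega>\<close>.\<close>

definition shift :: complex where
  "shift = of_real (b * d - a * c) / of_real (c\<^sup>2 - d\<^sup>2)"

lemma cnj_shift [simp]: "cnj shift = shift"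
  by (simp add: shift_def)

text \<open>Completing the product: up to an additive constant, \<open>Q x y\<close> is a nonzero
  multiple of \<open>(x + shift) * (y + shift)\<close>.\<close>

lemma Q_scaling:
  assumes "c\<^sup>2 \<noteq> d\<^sup>2"
  shows "Q x y = Q x' y' \<longleftrightarrow> (x + shift) * (y + shift) = (x' + shift) * (y' + shift)"
proof -
  let ?C = "of_real (c\<^sup>2 - d\<^sup>2) :: complex"
  have C: "?C \<noteq> 0"
    using assms by (simp only: of_real_eq_0_iff)
  have B: "of_real (b * d - a * c) = ?C * shift"
    using C by (simp add: shift_def)
  have "Q x y - Q x' y' = ?C * ((x + shift) * (y + shift) - (x' + shift) * (y' + shift))" for x y x' y'
    unfolding Q_def B by (simp add: algebra_simps del: of_real_diff)
  then show ?thesis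
    using C by (metis mult_eq_0_iff right_minus_eq)
qed

lemma Q_translation:
  assumes "c\<^sup>2 = d\<^sup>2"
  shows "Q x y = Q x' y' \<longleftrightarrow> x + y = x' + y'"
proof -
  \<comment> \<open>The discriminant identity; when the leading coefficient vanishes it shows that
    the coefficient of x + y does not.\<close>
  have "(b * d - a * c)\<^sup>2 - (a\<^sup>2 - b\<^sup>2) * (c\<^sup>2 - d\<^sup>2) = (a * d - b * c)\<^sup>2"
    by algebra
  then have "b * d - a * c \<noteq> 0"
    using assms det by auto
  then have "of_real (b * d - a * c) \<noteq> (0 :: complex)"
    by (simp only: of_real_eq_0_iff) simp
  then show ?thesis
    by (simp add: Q_def assms del: of_real_diff)
qed

text \<open>Two distinct points cannot both equal \<open>- shift\<close>. The point found serves as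
  a base point at which division is possible.\<close>

lemma ex_plus_shift_nonzero:
  obtains w where "w \<in> \<Omega>" "w + shift \<noteq> 0"
proof -
  have in_\<Omega>: "\<tau> 0 \<in> \<Omega>" "\<tau> (1 / 2) \<in> \<Omega>"
    by simp_all
  have "\<tau> 0 \<noteq> \<tau> (1 / 2)"
    using inj_onD[OF inj_\<tau>, of 0 "1 / 2"] by auto
  then have "\<tau> 0 + shift \<noteq> 0 \<or> \<tau> (1 / 2) + shift \<noteq> 0"
    by (metis add_right_cancel)
  then show ?thesis
    using that in_\<Omega> by blast
qed

section \<open>A unitary composition operator and the symmetry it induces\<close>

context
  fixes \<Psi> :: "complex \<Rightarrow> complex"
  assumes \<Psi>: "analytic_self_map \<Omega> \<Psi>"
    and unitary: "unitary_operator H ip (comp_op \<Omega> \<Psi>)"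
begin

lemma \<Psi>_in [simp]: "w \<in> \<Omega> \<Longrightarrow> \<Psi> w \<in> \<Omega>"
  using \<Psi> by (auto simp: analytic_self_map_def)

lemma comp_op_\<Psi>_in_H [simp]: "f \<in> H \<Longrightarrow> comp_op \<Omega> \<Psi> f \<in> H"
  using unitary by (simp add: unitary_operator_def bounded_operator_def)

text \<open>Removes the inverse operator from the conjugation; by \<open>unitary_surj\<close> every
  element of the space has the form of the argument.\<close>

lemma J_Omega_Psi_comp_op:
  assumes f: "f \<in> H"
  shows "J_Omega_Psi \<tau> s \<Omega> \<Psi> (comp_op \<Omega> \<Psi> f) = comp_op \<Omega> \<Psi> (J f)"
proof -
  have "inj_on (comp_op \<Omega> \<Psi>) H"
    using unitary_inject[OF unitary] by (rule inj_onI)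
  then show ?thesis
    using f by (simp add: J_Omega_Psi_def inv_into_f_f J_Omega_eq)
qed

lemma Q_unitary:
  assumes "z \<in> \<Omega>" "w \<in> \<Omega>"
  shows "Q (\<Psi> z) (cnj (\<Psi> w)) = Q z (cnj w)"
proof -
  have "kernel (\<Psi> w) (\<Psi> z) = kernel w z"
    using assms unitary_comp_op_kernel[OF unitary \<Psi>, of w] by (metis comp_op_apply)
  then show ?thesis
    using assms Q_nonzero[of z w] Q_nonzero[of "\<Psi> z" "\<Psi> w"] by (simp add: kernel_eq)
qed

lemma unitary_translation:
  assumes C: "c\<^sup>2 = d\<^sup>2"
  obtains \<mu> where "\<And>z. z \<in> \<Omega> \<Longrightarrow> \<Psi> z = z + \<mu>"
proof
  fix z assume z: "z \<in> \<Omega>"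
  have "Q (\<Psi> z) (cnj (\<Psi> (\<tau> 0))) = Q z (cnj (\<tau> 0))"
    using z by (intro Q_unitary) simp_all
  then have "\<Psi> z + cnj (\<Psi> (\<tau> 0)) = z + cnj (\<tau> 0)"
    using C Q_translation by simp
  then show "\<Psi> z = z + (cnj (\<tau> 0) - cnj (\<Psi> (\<tau> 0)))"
    by (simp add: algebra_simps)
qed

lemma unitary_scaling:
  assumes C: "c\<^sup>2 \<noteq> d\<^sup>2"
  obtains k where "k \<noteq> 0" "\<And>z. z \<in> \<Omega> \<Longrightarrow> \<Psi> z + shift = k * (z + shift)"
proof -
  obtain w where w: "w \<in> \<Omega>" "w + shift \<noteq> 0"
    using ex_plus_shift_nonzero .
  have *: "(\<Psi> z + shift) * (cnj (\<Psi> w) + shift) = (z + shift) * (cnj w + shift)" if "z \<in> \<Omega>" for z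
    using Q_unitary[OF that w(1)] Q_scaling[OF C] by blast
  have "cnj (w + shift) \<noteq> 0"
    using w by (simp only: complex_cnj_zero_iff) simp
  then have nz: "cnj w + shift \<noteq> 0"
    by (simp only: complex_cnj_add cnj_shift) simp
  \<comment> \<open>At z = w the right-hand side of the product identity is nonzero, hence so is
    each factor on the left.\<close>
  with *[OF w(1)] w(2) have "cnj (\<Psi> w) + shift \<noteq> 0"
    by auto
  then have "\<Psi> z + shift = (cnj w + shift) / (cnj (\<Psi> w) + shift) * (z + shift)" if "z \<in> \<Omega>" for z
    using *[OF that] by (simp add: field_simps)
  with nz \<open>cnj (\<Psi> w) + shift \<noteq> 0\<close> show ?thesis
    using that[of "(cnj w + shift) / (cnj (\<Psi> w) + shift)"] by simp
qed

text \<open>Symmetry is tested on the function that the conjugation sends to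
  \<open>kernel w\<close>, where the adjoint is known. Stripping off \<Psi> and \<open>J\<close>
  leaves an equality of conjugated kernels.\<close>

lemma C_symmetric_Q:
  assumes \<Phi>: "analytic_self_map \<Omega> \<Phi>"
    and sym: "C_symmetric H ip (J_Omega_Psi \<tau> s \<Omega> \<Psi>) (comp_op \<Omega> \<Phi>)"
    and z: "z \<in> \<Omega>" and w: "w \<in> \<Omega>"
  shows "Q (\<Psi> (\<Phi> z)) (\<Psi> w) = Q (\<Psi> z) (\<Psi> (\<Phi> w))"
proof -
  let ?T = "comp_op \<Omega> \<Phi>" and ?U = "comp_op \<Omega> \<Psi>" and ?C = "J_Omega_Psi \<tau> s \<Omega> \<Psi>"
  have \<Phi>_in: "\<Phi> z \<in> \<Omega>" "\<Phi> w \<in> \<Omega>"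
    using \<Phi> z w by (auto simp: analytic_self_map_def)
  have bounded: "bounded_operator H ip ?T"
    using sym by (simp add: C_symmetric_def)
  define f where "f = ?U (J (kernel (\<Psi> w)))"
  have f: "f \<in> H"
    using w by (simp add: f_def)
  then have Tf: "?T f \<in> H"
    using bounded by (simp add: bounded_operator_def)
  \<comment> \<open>A preimage of \<open>?T f\<close>, needed to bring \<open>?C (?T f)\<close> into
    the form of \<open>J_Omega_Psi_comp_op\<close>.\<close>
  obtain h where h: "h \<in> H" "?U h = ?T f"
    using unitary_surj[OF unitary Tf] .
  have "?U (J h) = ?C (?T f)"
    using h by (simp flip: J_Omega_Psi_comp_op)
  also have "\<dots> = adj ?T (?C f)"
    using sym f by (simp add: C_symmetric_def)
  also have "?C f = kernel w"
    using w unitary_comp_op_kernel[OF unitary \<Psi>] by (simp add: f_def J_Omega_Psi_comp_op)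
  also have "adj ?T (kernel w) = kernel (\<Phi> w)"
    by (rule adj_comp_op_kernel[OF bounded \<Phi> w])
  also have "\<dots> = ?U (kernel (\<Psi> (\<Phi> w)))"
    using \<Phi>_in unitary_comp_op_kernel[OF unitary \<Psi>] by simp
  finally have "J h = kernel (\<Psi> (\<Phi> w))"
    using h \<Phi>_in by (rule_tac unitary_inject[OF unitary]) simp_all
  then have h_eq: "h = J (kernel (\<Psi> (\<Phi> w)))"
    by (metis J_J)
  have "J (kernel (\<Psi> w)) (\<Psi> (\<Phi> z)) = J (kernel (\<Psi> (\<Phi> w))) (\<Psi> z)"
    using fun_cong[OF h(2), of z] z \<Phi>_in by (simp add: comp_op_apply f_def h_eq)
  then show ?thesis
    using z w \<Phi>_in Q_nonzero[of _ "cnj _"] by (simp add: J_kernel_apply)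
qed

text \<open>\<open>Q_\<Phi>\<close> makes the operator permute kernels, which gives the adjoint
  pointwise. \<open>comm\<close> moves \<Psi> past the operator inside the conjugation, and
  \<open>comm_cnj\<close> matches the points at which the two sides are evaluated.\<close>

lemma C_symmetricI:
  assumes \<Phi>: "analytic_self_map \<Omega> \<Phi>"
    and bounded: "bounded_operator H ip (comp_op \<Omega> \<Phi>)"
    and Q_\<Phi>: "\<And>z w. z \<in> \<Omega> \<Longrightarrow> w \<in> \<Omega> \<Longrightarrow> Q (\<Phi> z) w = Q z (\<Phi> w)"
    and comm: "\<And>z. z \<in> \<Omega> \<Longrightarrow> \<Psi> (\<Phi> z) = \<Phi> (\<Psi> z)"
    and comm_cnj: "\<And>z. z \<in> \<Omega> \<Longrightarrow> \<Psi> (cnj (\<Phi> (cnj z))) = cnj (\<Phi> (cnj (\<Psi> z)))"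
  shows "C_symmetric H ip (J_Omega_Psi \<tau> s \<Omega> \<Psi>) (comp_op \<Omega> \<Phi>)"
  unfolding C_symmetric_def
proof (intro conjI ballI bounded)
  let ?T = "comp_op \<Omega> \<Phi>" and ?U = "comp_op \<Omega> \<Psi>" and ?C = "J_Omega_Psi \<tau> s \<Omega> \<Psi>"
  fix f assume f: "f \<in> H"
  obtain g where g: "g \<in> H" "?U g = f"
    using unitary_surj[OF unitary f] .
  have \<Phi>_in: "\<Phi> z \<in> \<Omega>" if "z \<in> \<Omega>" for z
    using \<Phi> that by (auto simp: analytic_self_map_def)
  have T_in: "?T x \<in> H" if "x \<in> H" for x
    using bounded that by (simp add: bounded_operator_def)
  have Cf: "?C f = ?U (J g)"
    using J_Omega_Psi_comp_op[OF g(1)] g(2) by simp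
  then have Cf_in: "?C f \<in> H"
    using g by simp
  have "?U (?T g) = ?T f"
    using g(2) \<Phi>_in by (auto simp: comp_op_def comm)
  then have CTf: "?C (?T f) = ?U (J (?T g))"
    using J_Omega_Psi_comp_op[OF T_in[OF g(1)]] by simp
  show "?C (?T f) = adj ?T (?C f)"
  proof (rule H_eqI)
    show "?C (?T f) \<in> H"
      using CTf g T_in by simp
    show "adj ?T (?C f) \<in> H"
      by (rule adj_works(1)[OF bounded Cf_in])
    fix w assume w: "w \<in> \<Omega>"
    define w' where "w' = cnj (\<Phi> (cnj w))"
    have w': "w' \<in> \<Omega>"
      using w \<Phi>_in by (simp add: w'_def)
    have "?T (kernel w) = kernel w'"
    proof (rule H_eqI)
      fix z assume z: "z \<in> \<Omega>"
      have "Q (\<Phi> z) (cnj w) = Q z (cnj w')"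
        using Q_\<Phi>[of z "cnj w"] z w by (simp add: w'_def)
      then show "?T (kernel w) z = kernel w' z"
        using z w w' \<Phi>_in by (simp add: comp_op_apply kernel_eq)
    qed (use w w' T_in in auto)
    then have "adj ?T (?C f) w = ?C f w'"
      using adj_apply[OF bounded Cf_in w] kernel_ip[OF Cf_in w'] by simp
    also have "\<dots> = ?C (?T f) w"
      unfolding Cf CTf using w w' comm_cnj[OF w] by (simp add: comp_op_apply J_def w'_def)
    finally show "?C (?T f) w = adj ?T (?C f) w" ..
  qed
qed

lemma C_symmetric_imp_translation:
  assumes \<Phi>: "analytic_self_map \<Omega> \<Phi>"
    and sym: "C_symmetric H ip (J_Omega_Psi \<tau> s \<Omega> \<Psi>) (comp_op \<Omega> \<Phi>)"
    and C: "c\<^sup>2 = d\<^sup>2"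
  shows "\<exists>r. \<forall>w\<in>\<Omega>. \<Phi> w = w + r"
proof -
  have \<Phi>_in: "\<Phi> w \<in> \<Omega>" if "w \<in> \<Omega>" for w
    using \<Phi> that by (auto simp: analytic_self_map_def)
  obtain \<mu> where \<mu>: "\<And>z. z \<in> \<Omega> \<Longrightarrow> \<Psi> z = z + \<mu>"
    using unitary_translation[OF C] by metis
  have w: "\<tau> 0 \<in> \<Omega>"
    by simp
  have "\<Phi> z = z + (\<Phi> (\<tau> 0) - \<tau> 0)" if "z \<in> \<Omega>" for z
    using C_symmetric_Q[OF \<Phi> sym that w] that w \<Phi>_in
    by (simp add: Q_translation[OF C] \<mu> algebra_simps)
  then show ?thesis
    by blast
qed

lemma C_symmetric_imp_scaling:
  assumes \<Phi>: "analytic_self_map \<Omega> \<Phi>"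
    and sym: "C_symmetric H ip (J_Omega_Psi \<tau> s \<Omega> \<Psi>) (comp_op \<Omega> \<Phi>)"
    and C: "c\<^sup>2 \<noteq> d\<^sup>2"
  shows "\<exists>r. \<forall>w\<in>\<Omega>. \<Phi> w = r * w + (r - 1) * shift"
proof -
  have \<Phi>_in: "\<Phi> w \<in> \<Omega>" if "w \<in> \<Omega>" for w
    using \<Phi> that by (auto simp: analytic_self_map_def)
  obtain k where k: "k \<noteq> 0" "\<And>z. z \<in> \<Omega> \<Longrightarrow> \<Psi> z + shift = k * (z + shift)"
    using unitary_scaling[OF C] by metis
  obtain w where w: "w \<in> \<Omega>" "w + shift \<noteq> 0"
    using ex_plus_shift_nonzero .
  \<comment> \<open>The value at the base point forces the ratio; the factors \<open>k\<close> from
    \<Psi> cancel below.\<close>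
  define r where "r = (\<Phi> w + shift) / (w + shift)"
  have "\<Phi> z = r * z + (r - 1) * shift" if z: "z \<in> \<Omega>" for z
  proof -
    have "(k * (\<Phi> z + shift)) * (k * (w + shift)) = (k * (z + shift)) * (k * (\<Phi> w + shift))"
      using C_symmetric_Q[OF \<Phi> sym z w(1)] z w \<Phi>_in by (simp only: Q_scaling[OF C] k(2))
    then have "(\<Phi> z + shift) * (w + shift) = (z + shift) * (\<Phi> w + shift)"
      using k(1) by simp
    then have "\<Phi> z + shift = r * (z + shift)"
      using w by (simp add: r_def eq_divide_eq mult.commute)
    then show ?thesis
      by (simp add: algebra_simps eq_diff_eq)
  qed
  then show ?thesis
    by blast
qed

lemma translation_imp_C_symmetric:
  assumes \<Phi>: "analytic_self_map \<Omega> \<Phi>"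
    and bounded: "bounded_operator H ip (comp_op \<Omega> \<Phi>)"
    and C: "c\<^sup>2 = d\<^sup>2"
    and r: "\<And>w. w \<in> \<Omega> \<Longrightarrow> \<Phi> w = w + r"
  shows "C_symmetric H ip (J_Omega_Psi \<tau> s \<Omega> \<Psi>) (comp_op \<Omega> \<Phi>)"
proof -
  have \<Phi>_in: "\<Phi> w \<in> \<Omega>" if "w \<in> \<Omega>" for w
    using \<Phi> that by (auto simp: analytic_self_map_def)
  obtain \<mu> where \<mu>: "\<And>z. z \<in> \<Omega> \<Longrightarrow> \<Psi> z = z + \<mu>"
    using unitary_translation[OF C] by metis
  show ?thesis
  proof (rule C_symmetricI[OF \<Phi> bounded])
    fix z w assume z: "z \<in> \<Omega>" and w: "w \<in> \<Omega>"
    show "Q (\<Phi> z) w = Q z (\<Phi> w)"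
      using z w by (simp add: Q_translation[OF C] r)
  next
    fix z assume z: "z \<in> \<Omega>"
    have "\<Psi> (\<Phi> z) = z + r + \<mu>"
      using \<mu>[OF \<Phi>_in[OF z]] by (simp only: r[OF z])
    also have "\<dots> = \<Psi> z + r"
      by (simp add: \<mu>[OF z])
    also have "\<dots> = \<Phi> (\<Psi> z)"
      by (rule r[symmetric]) (simp add: z)
    finally show "\<Psi> (\<Phi> z) = \<Phi> (\<Psi> z)" .
    have "\<Psi> (cnj (\<Phi> (cnj z))) = cnj (\<Phi> (cnj z)) + \<mu>"
      using z \<Phi>_in by (intro \<mu>) simp
    also have "\<dots> = cnj (cnj (\<Psi> z) + r)"
      using z by (simp add: \<mu> r)
    also have "\<dots> = cnj (\<Phi> (cnj (\<Psi> z)))"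
      using z by (subst r) simp_all
    finally show "\<Psi> (cnj (\<Phi> (cnj z))) = cnj (\<Phi> (cnj (\<Psi> z)))" .
  qed
qed

text \<open>Dilations about a common centre commute, and the centre \<open>- shift\<close> is real,
  so conjugating \<Phi> only conjugates its ratio.\<close>

lemma scaling_imp_C_symmetric:
  assumes \<Phi>: "analytic_self_map \<Omega> \<Phi>"
    and bounded: "bounded_operator H ip (comp_op \<Omega> \<Phi>)"
    and C: "c\<^sup>2 \<noteq> d\<^sup>2"
    and r: "\<And>w. w \<in> \<Omega> \<Longrightarrow> \<Phi> w = r * w + (r - 1) * shift"
  shows "C_symmetric H ip (J_Omega_Psi \<tau> s \<Omega> \<Psi>) (comp_op \<Omega> \<Phi>)"
proof -
  have \<Phi>_in: "\<Phi> w \<in> \<Omega>" if "w \<in> \<Omega>" for w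
    using \<Phi> that by (auto simp: analytic_self_map_def)
  obtain k where k: "\<And>z. z \<in> \<Omega> \<Longrightarrow> \<Psi> z + shift = k * (z + shift)"
    using unitary_scaling[OF C] by metis
  have r': "\<Phi> w + shift = r * (w + shift)" if "w \<in> \<Omega>" for w
    using r[OF that] by (simp add: algebra_simps)
  have cnj_r': "cnj (\<Phi> w) + shift = cnj r * (cnj w + shift)"
    and cnj_k: "cnj (\<Psi> w) + shift = cnj k * (cnj w + shift)" if "w \<in> \<Omega>" for w
    using arg_cong[OF r'[OF that], of cnj] arg_cong[OF k[OF that], of cnj] by simp_all
  show ?thesis
  proof (rule C_symmetricI[OF \<Phi> bounded])
    fix z w assume z: "z \<in> \<Omega>" and w: "w \<in> \<Omega>"
    show "Q (\<Phi> z) w = Q z (\<Phi> w)"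
      using z w by (simp add: Q_scaling[OF C] r')
  next
    fix z assume z: "z \<in> \<Omega>"
    have "\<Psi> (\<Phi> z) + shift = \<Phi> (\<Psi> z) + shift"
      using z \<Phi>_in by (simp only: k r' \<Psi>_in) simp
    then show "\<Psi> (\<Phi> z) = \<Phi> (\<Psi> z)"
      by simp
    have "\<Psi> (cnj (\<Phi> (cnj z))) + shift = cnj (\<Phi> (cnj (\<Psi> z))) + shift"
      using z \<Phi>_in by (simp only: k cnj_r' cnj_k \<Psi>_in cnj_in complex_cnj_cnj) simp
    then show "\<Psi> (cnj (\<Phi> (cnj z))) = cnj (\<Phi> (cnj (\<Psi> z)))"
      by simp
  qed
qed

end

end

theorem proposition5p5:
  fixes \<Omega> :: "complex set" and \<tau> s \<Phi> \<Psi> :: "complex \<Rightarrow> complex" and a b c d :: real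
  assumes "open \<Omega>" and "simply_connected \<Omega>" and "\<Omega> \<noteq> UNIV"
    and "riemann_map \<tau> \<Omega>"
    and "a * d - b * c \<noteq> 0"
    and "\<And>z. z \<in> ball 0 1 \<Longrightarrow>
           \<tau> z = (complex_of_real a * z + complex_of_real b) /
                  (complex_of_real c * z + complex_of_real d)"
    and "analytic_sqrt_deriv \<tau> s"
    and "analytic_self_map \<Omega> \<Psi>"
    and "unitary_operator (hardy_smirnov \<tau> \<Omega>) (hs_inner \<tau> s) (comp_op \<Omega> \<Psi>)"
    and "analytic_self_map \<Omega> \<Phi>"
  shows
    "(C_symmetric (hardy_smirnov \<tau> \<Omega>) (hs_inner \<tau> s) (J_Omega_Psi \<tau> s \<Omega> \<Psi>) (comp_op \<Omega> \<Phi>) \<longrightarrow>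
        (\<bar>c\<bar>\<^sup>2 = \<bar>d\<bar>\<^sup>2 \<longrightarrow> (\<exists>r::complex. \<forall>w\<in>\<Omega>. \<Phi> w = w + r)) \<and>
        (\<bar>c\<bar>\<^sup>2 \<noteq> \<bar>d\<bar>\<^sup>2 \<longrightarrow> (\<exists>r::complex. \<forall>w\<in>\<Omega>.
            \<Phi> w = r * w + (r - 1) * complex_of_real (b * d - a * c) / complex_of_real (\<bar>c\<bar>\<^sup>2 - \<bar>d\<bar>\<^sup>2))))
     \<and>
     (((\<bar>c\<bar>\<^sup>2 = \<bar>d\<bar>\<^sup>2 \<and> (\<exists>r::complex. \<forall>w\<in>\<Omega>. \<Phi> w = w + r)) \<or>
       (\<bar>c\<bar>\<^sup>2 \<noteq> \<bar>d\<bar>\<^sup>2 \<and> (\<exists>r::complex. \<forall>w\<in>\<Omega>.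
            \<Phi> w = r * w + (r - 1) * complex_of_real (b * d - a * c) / complex_of_real (\<bar>c\<bar>\<^sup>2 - \<bar>d\<bar>\<^sup>2)))) \<longrightarrow>
      bounded_operator (hardy_smirnov \<tau> \<Omega>) (hs_inner \<tau> s) (comp_op \<Omega> \<Phi>) \<longrightarrow>
      C_symmetric (hardy_smirnov \<tau> \<Omega>) (hs_inner \<tau> s) (J_Omega_Psi \<tau> s \<Omega> \<Psi>) (comp_op \<Omega> \<Phi>))"
proof -
  interpret real_moebius_hardy_smirnov \<tau> s \<Omega> a b c d
    using assms(4-7) by unfold_locales auto
  note \<Psi> = assms(8,9) and \<Phi> = assms(10)
  \<comment> \<open>Rewritten before \<open>power2_abs\<close>, because the left-hand side still
    contains the absolute values of the statement.\<close>
  have affine: "r * w + (r - 1) * complex_of_real (b * d - a * c) / complex_of_real (\<bar>c\<bar>\<^sup>2 - \<bar>d\<bar>\<^sup>2) =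
      r * w + (r - 1) * shift" for r w
    by (simp only: shift_def power2_abs times_divide_eq_right)
  show ?thesis
    unfolding affine unfolding power2_abs
    using C_symmetric_imp_translation[OF \<Psi> \<Phi>] C_symmetric_imp_scaling[OF \<Psi> \<Phi>]
      translation_imp_C_symmetric[OF \<Psi> \<Phi>] scaling_imp_C_symmetric[OF \<Psi> \<Phi>]
    by blast
qed

end
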